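(* Let $K=K^i_j$ be a smooth $(1,1)$-tensor field on a smooth manifold $M$ of dimension $n$. Assume that $K$ has $n$ distinct eigenvalues at every point and that the Haantjes torsion of $K$ vanishes identically. Then there exists locally (i.e. in a neighbourhood of every point) a metric $g$ for which $K$ generates separation of variables if and only if (I) $K$ is weakly nonlinear, and (II) $K$ is semi-hamiltonian.
   Context: A metric is a smooth nondegenerate symmetric $(0,2)$-tensor field $g=g_{ij}$ of any signature. All existence statements are local: they concern a sufficiently small neighbourhood of an arbitrary point. Repeated indices are summed unless they are indices of eigenvalues. Generating separation of variables. A $(1,1)$-tensor field $K$ generates (orthogonal) separation of variables for a metric $g$ if: (a) $K$ has $n=\dim M$ distinct eigenvalues; (b) there exists a local coordinate system $(x^1,\dots,x^n)$ in which $K$ is given by a diagonal matrix $\operatorname{diag}(K_1,\dots,K_n)$, where the $K_i$ are functions of $x^1,\dots,x^n$; (c) the $(0,2)$-tensor field $K_{ij}:=g_{si}K^s_j$ is Killing, i.e. it is symmetric, $K_{ij}=K_{ji}$, and $K_{ij,k}+K_{jk,i}+K_{ki,j}=0$, where the comma denotes covariant differentiation with respect to the Levi-Civita connection of $g$. Haantjes torsion. For a $(1,1)$-tensor field $A$, the Nijenhuis torsion is $N(X,Y)=[AX,AY]+A^2[X,Y]-A[AX,Y]-A[X,AY]$ for vector fields $X,Y$, and the Haantjes torsion is $H(X,Y)=A^2N(X,Y)+N(AX,AY)-A\,N(AX,Y)-A\,N(X,AY)$. Weakly nonlinear. A $(1,1)$-tensor field with $n$ distinct eigenvalues is weakly nonlinear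 if the derivative of every eigenvalue (which is locally a smooth function) in the direction of its eigenvector is zero, i.e. $d\lambda(v)=0$ whenever $Av=\lambda v$. If an eigenvalue is complex, $d\lambda$ is extended complex-linearly to the complexified tangent space. Semi-hamiltonian. A $(1,1)$-tensor field $A$ with $n$ distinct eigenvalues is semi-hamiltonian if near every point there exists a (real) coordinate system $(u^1,\dots,u^n)$ in which $A$ is diagonal, $A=\operatorname{diag}(A_1,\dots,A_n)$, and for all pairwise distinct indices $i,j,k$ $$\frac{\partial}{\partial u^k}\left(\frac{1}{A_j-A_i}\frac{\partial A_i}{\partial u^j}\right)=\frac{\partial}{\partial u^j}\left(\frac{1}{A_k-A_i}\frac{\partial A_i}{\partial u^k}\right).$$ *)

theory Defs
  imports "HOL-Analysis.Analysis"
begin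

subsection \<open>Smooth manifolds\<close>

fun Ck_on :: "nat \<Rightarrow> ('a::real_normed_vector \<Rightarrow> 'b::real_normed_vector) \<Rightarrow> 'a set \<Rightarrow> bool" where
  "Ck_on 0 f S \<longleftrightarrow> continuous_on S f"
| "Ck_on (Suc k) f S \<longleftrightarrow> (\<forall>x\<in>S. f differentiable (at x)) \<and>
     (\<forall>v. Ck_on k (\<lambda>x. frechet_derivative f (at x) v) S)"

text \<open>Meaningful only for open \<open>S\<close>, since the derivatives are two-sided.\<close>

definition smooth_on :: "('a::real_normed_vector \<Rightarrow> 'b::real_normed_vector) \<Rightarrow> 'a set \<Rightarrow> bool" where
  "smooth_on f S \<longleftrightarrow> (\<forall>k. Ck_on k f S)"

text \<open>A chart is a domain together with a total map, of which only the values on the domain matter.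
  The manifold is the whole type \<open>'m\<close> and its dimension is \<open>CARD('n)\<close>.\<close>

type_synonym ('m, 'n) chart = "'m set \<times> ('m \<Rightarrow> real^'n)"

definition inv_chart :: "('m, 'n) chart \<Rightarrow> real^'n \<Rightarrow> 'm" where
  "inv_chart c = inv_into (fst c) (snd c)"

definition is_chart :: "('m::topological_space, 'n::finite) chart \<Rightarrow> bool" where
  "is_chart c \<longleftrightarrow> open (fst c) \<and> open (snd c ` fst c) \<and>
     homeomorphism (fst c) (snd c ` fst c) (snd c) (inv_chart c)"

definition compatible :: "('m, 'n::finite) chart \<Rightarrow> ('m, 'n) chart \<Rightarrow> bool" where
  "compatible c d \<longleftrightarrow>
     smooth_on (snd d \<circ> inv_chart c) (snd c ` (fst c \<inter> fst d)) \<and>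
     smooth_on (snd c \<circ> inv_chart d) (snd d ` (fst c \<inter> fst d))"

text \<open>A smooth structure is a maximal smooth atlas, so its members are exactly the
  local coordinate systems of the manifold.\<close>

definition smooth_structure :: "('m::topological_space, 'n::finite) chart set \<Rightarrow> bool" where
  "smooth_structure \<A> \<longleftrightarrow>
     (\<forall>c\<in>\<A>. is_chart c) \<and>
     (\<Union>c\<in>\<A>. fst c) = UNIV \<and>
     (\<forall>c\<in>\<A>. \<forall>d\<in>\<A>. compatible c d) \<and>
     (\<forall>c. is_chart c \<and> (\<forall>d\<in>\<A>. compatible c d) \<longrightarrow> c \<in> \<A>)"

definition smooth_map_on ::
  "('m, 'n::finite) chart set \<Rightarrow> 'm set \<Rightarrow> ('m \<Rightarrow> 'b::real_normed_vector) \<Rightarrow> bool" where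
  "smooth_map_on \<A> W f \<longleftrightarrow> (\<forall>c\<in>\<A>. smooth_on (f \<circ> inv_chart c) (snd c ` (fst c \<inter> W)))"

text \<open>\<open>\<partial>f/\<partial>x\<^sup>i\<close> at \<open>p\<close>, where \<open>x\<close> are the coordinates of the chart \<open>c\<close>.\<close>

definition pderiv_chart ::
  "('m, 'n::finite) chart \<Rightarrow> 'n \<Rightarrow> ('m \<Rightarrow> 'b::real_normed_vector) \<Rightarrow> 'm \<Rightarrow> 'b" where
  "pderiv_chart c i f p = frechet_derivative (f \<circ> inv_chart c) (at (snd c p)) (axis i 1)"

text \<open>\<open>(\<partial>y\<^sup>i/\<partial>x\<^sup>j)\<close> with \<open>x\<close> the coordinates of \<open>c\<close> and \<open>y\<close> those of \<open>d\<close>.\<close>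

definition jacobian ::
  "('m, 'n::finite) chart \<Rightarrow> ('m, 'n) chart \<Rightarrow> 'm \<Rightarrow> real^'n^'n" where
  "jacobian c d p = (\<chi> i j. pderiv_chart c j (\<lambda>q. snd d q $ i) p)"

subsection \<open>Tensor fields\<close>

text \<open>A tensor field on an open set \<open>W\<close> is given by its components in every chart, as functions
  of the point, subject to the transformation law of its type. In the matrix of a (1,1)-tensor
  field the row is the upper index, \<open>K c p $ i $ j = K\<^sup>i\<^sub>j\<close>.\<close>

definition smooth_components ::
  "('m, 'n::finite) chart set \<Rightarrow> 'm set \<Rightarrow>
   (('m, 'n) chart \<Rightarrow> 'm \<Rightarrow> 'b::real_normed_vector) \<Rightarrow> bool" where
  "smooth_components \<A> W T \<longleftrightarrow>
     (\<forall>c\<in>\<A>. smooth_on (T c \<circ> inv_chart c) (snd c ` (fst c \<inter> W)))"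

definition vector_field_on ::
  "('m, 'n::finite) chart set \<Rightarrow> 'm set \<Rightarrow> (('m, 'n) chart \<Rightarrow> 'm \<Rightarrow> real^'n) \<Rightarrow> bool" where
  "vector_field_on \<A> W X \<longleftrightarrow> smooth_components \<A> W X \<and>
     (\<forall>c\<in>\<A>. \<forall>d\<in>\<A>. \<forall>p \<in> fst c \<inter> fst d \<inter> W. X d p = jacobian c d p *v X c p)"

definition tensor11_on ::
  "('m, 'n::finite) chart set \<Rightarrow> 'm set \<Rightarrow> (('m, 'n) chart \<Rightarrow> 'm \<Rightarrow> real^'n^'n) \<Rightarrow> bool" where
  "tensor11_on \<A> W K \<longleftrightarrow> smooth_components \<A> W K \<and>
     (\<forall>c\<in>\<A>. \<forall>d\<in>\<A>. \<forall>p \<in> fst c \<inter> fst d \<inter> W.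
        K d p = jacobian c d p ** K c p ** jacobian d c p)"

definition tensor02_on ::
  "('m, 'n::finite) chart set \<Rightarrow> 'm set \<Rightarrow> (('m, 'n) chart \<Rightarrow> 'm \<Rightarrow> real^'n^'n) \<Rightarrow> bool" where
  "tensor02_on \<A> W g \<longleftrightarrow> smooth_components \<A> W g \<and>
     (\<forall>c\<in>\<A>. \<forall>d\<in>\<A>. \<forall>p \<in> fst c \<inter> fst d \<inter> W.
        g d p = transpose (jacobian d c p) ** g c p ** jacobian d c p)"

definition metric_on ::
  "('m, 'n::finite) chart set \<Rightarrow> 'm set \<Rightarrow> (('m, 'n) chart \<Rightarrow> 'm \<Rightarrow> real^'n^'n) \<Rightarrow> bool" where
  "metric_on \<A> W g \<longleftrightarrow> tensor02_on \<A> W g \<and>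
     (\<forall>c\<in>\<A>. \<forall>p \<in> fst c \<inter> W. transpose (g c p) = g c p \<and> invertible (g c p))"

subsection \<open>Nijenhuis and Haantjes torsion\<close>

definition lie_bracket ::
  "(('m, 'n::finite) chart \<Rightarrow> 'm \<Rightarrow> real^'n) \<Rightarrow> (('m, 'n) chart \<Rightarrow> 'm \<Rightarrow> real^'n) \<Rightarrow>
   ('m, 'n) chart \<Rightarrow> 'm \<Rightarrow> real^'n" where
  "lie_bracket X Y c p =
     (\<chi> i. \<Sum>j\<in>UNIV. X c p $ j * pderiv_chart c j (\<lambda>q. Y c q $ i) p
                   - Y c p $ j * pderiv_chart c j (\<lambda>q. X c q $ i) p)"

definition app ::
  "(('m, 'n::finite) chart \<Rightarrow> 'm \<Rightarrow> real^'n^'n) \<Rightarrow> (('m, 'n) chart \<Rightarrow> 'm \<Rightarrow> real^'n) \<Rightarrow>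
   ('m, 'n) chart \<Rightarrow> 'm \<Rightarrow> real^'n" where
  "app A X c p = A c p *v X c p"

definition nijenhuis ::
  "(('m, 'n::finite) chart \<Rightarrow> 'm \<Rightarrow> real^'n^'n) \<Rightarrow> (('m, 'n) chart \<Rightarrow> 'm \<Rightarrow> real^'n) \<Rightarrow>
   (('m, 'n) chart \<Rightarrow> 'm \<Rightarrow> real^'n) \<Rightarrow> ('m, 'n) chart \<Rightarrow> 'm \<Rightarrow> real^'n" where
  "nijenhuis A X Y c p =
     lie_bracket (app A X) (app A Y) c p + app A (app A (lie_bracket X Y)) c p
     - app A (lie_bracket (app A X) Y) c p - app A (lie_bracket X (app A Y)) c p"

definition haantjes ::
  "(('m, 'n::finite) chart \<Rightarrow> 'm \<Rightarrow> real^'n^'n) \<Rightarrow> (('m, 'n) chart \<Rightarrow> 'm \<Rightarrow> real^'n) \<Rightarrow>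
   (('m, 'n) chart \<Rightarrow> 'm \<Rightarrow> real^'n) \<Rightarrow> ('m, 'n) chart \<Rightarrow> 'm \<Rightarrow> real^'n" where
  "haantjes A X Y c p =
     app A (app A (nijenhuis A X Y)) c p + nijenhuis A (app A X) (app A Y) c p
     - app A (nijenhuis A (app A X) Y) c p - app A (nijenhuis A X (app A Y)) c p"

definition haantjes_vanishes ::
  "('m, 'n::finite) chart set \<Rightarrow> (('m, 'n) chart \<Rightarrow> 'm \<Rightarrow> real^'n^'n) \<Rightarrow> bool" where
  "haantjes_vanishes \<A> A \<longleftrightarrow>
     (\<forall>X Y. vector_field_on \<A> UNIV X \<and> vector_field_on \<A> UNIV Y \<longrightarrow>
        (\<forall>c\<in>\<A>. \<forall>p \<in> fst c. haantjes A X Y c p = 0))"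

subsection \<open>Eigenvalues\<close>

text \<open>Eigenvalues and eigenvectors are those of the complexified tensor.\<close>

definition cmatrix :: "real^'n^'m \<Rightarrow> complex^'n^'m" where
  "cmatrix B = (\<chi> i j. complex_of_real (B $ i $ j))"

definition eigenvalues :: "real^'n^'n \<Rightarrow> complex set" where
  "eigenvalues B = {l. \<exists>v. v \<noteq> 0 \<and> cmatrix B *v v = l *s v}"

definition distinct_eigenvalues_on ::
  "('m, 'n::finite) chart set \<Rightarrow> 'm set \<Rightarrow> (('m, 'n) chart \<Rightarrow> 'm \<Rightarrow> real^'n^'n) \<Rightarrow> bool" where
  "distinct_eigenvalues_on \<A> W A \<longleftrightarrow>
     (\<forall>c\<in>\<A>. \<forall>p \<in> fst c \<inter> W. card (eigenvalues (A c p)) = CARD('n))"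

definition diagonal_on ::
  "('m, 'n::finite) chart \<Rightarrow> (('m, 'n) chart \<Rightarrow> 'm \<Rightarrow> real^'n^'n) \<Rightarrow> bool" where
  "diagonal_on c A \<longleftrightarrow> (\<forall>q \<in> fst c. \<forall>i j. i \<noteq> j \<longrightarrow> A c q $ i $ j = 0)"

text \<open>The sum in the conclusion is the complex-linear extension of \<open>d\<lambda>\<close> applied to \<open>v\<close>.\<close>

definition weakly_nonlinear ::
  "('m::topological_space, 'n::finite) chart set \<Rightarrow>
   (('m, 'n) chart \<Rightarrow> 'm \<Rightarrow> real^'n^'n) \<Rightarrow> bool" where
  "weakly_nonlinear \<A> A \<longleftrightarrow>
     (\<forall>V (l :: 'm \<Rightarrow> complex). open V \<and> smooth_map_on \<A> V l \<and>
        (\<forall>c\<in>\<A>. \<forall>q \<in> fst c \<inter> V. l q \<in> eigenvalues (A c q)) \<longrightarrow>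
        (\<forall>c\<in>\<A>. \<forall>p \<in> fst c \<inter> V. \<forall>v. cmatrix (A c p) *v v = l p *s v \<longrightarrow>
           (\<Sum>i\<in>UNIV. v $ i * pderiv_chart c i l p) = 0))"

definition semi_hamiltonian ::
  "('m, 'n::finite) chart set \<Rightarrow> (('m, 'n) chart \<Rightarrow> 'm \<Rightarrow> real^'n^'n) \<Rightarrow> bool" where
  "semi_hamiltonian \<A> A \<longleftrightarrow>
     (\<forall>p. \<exists>c\<in>\<A>. p \<in> fst c \<and> diagonal_on c A \<and>
        (\<forall>i j k. i \<noteq> j \<and> j \<noteq> k \<and> i \<noteq> k \<longrightarrow> (\<forall>q \<in> fst c.
           pderiv_chart c k
             (\<lambda>r. 1 / (A c r $ j $ j - A c r $ i $ i) * pderiv_chart c j (\<lambda>s. A c s $ i $ i) r) q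
         = pderiv_chart c j
             (\<lambda>r. 1 / (A c r $ k $ k - A c r $ i $ i) * pderiv_chart c k (\<lambda>s. A c s $ i $ i) r) q)))"

subsection \<open>Killing tensors and separation of variables\<close>

text \<open>\<open>christoffel g c k i j p\<close> is \<open>\<Gamma>\<^sup>k\<^sub>i\<^sub>j\<close> at \<open>p\<close> in the chart \<open>c\<close>.\<close>

definition christoffel ::
  "(('m, 'n::finite) chart \<Rightarrow> 'm \<Rightarrow> real^'n^'n) \<Rightarrow> ('m, 'n) chart \<Rightarrow>
   'n \<Rightarrow> 'n \<Rightarrow> 'n \<Rightarrow> 'm \<Rightarrow> real" where
  "christoffel g c k i j p =
     1/2 * (\<Sum>l\<in>UNIV. matrix_inv (g c p) $ k $ l *
       (pderiv_chart c i (\<lambda>q. g c q $ j $ l) p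
        + pderiv_chart c j (\<lambda>q. g c q $ i $ l) p
        - pderiv_chart c l (\<lambda>q. g c q $ i $ j) p))"

text \<open>\<open>cov_deriv g T c i j k p\<close> is \<open>T\<^sub>i\<^sub>j\<^sub>,\<^sub>k\<close>: the derivative is in the direction of the last index.\<close>

definition cov_deriv ::
  "(('m, 'n::finite) chart \<Rightarrow> 'm \<Rightarrow> real^'n^'n) \<Rightarrow> (('m, 'n) chart \<Rightarrow> 'm \<Rightarrow> real^'n^'n) \<Rightarrow>
   ('m, 'n) chart \<Rightarrow> 'n \<Rightarrow> 'n \<Rightarrow> 'n \<Rightarrow> 'm \<Rightarrow> real" where
  "cov_deriv g T c i j k p =
     pderiv_chart c k (\<lambda>q. T c q $ i $ j) p
     - (\<Sum>s\<in>UNIV. christoffel g c s k i p * T c p $ s $ j)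
     - (\<Sum>s\<in>UNIV. christoffel g c s k j p * T c p $ i $ s)"

definition killing_on ::
  "('m, 'n::finite) chart set \<Rightarrow> 'm set \<Rightarrow> (('m, 'n) chart \<Rightarrow> 'm \<Rightarrow> real^'n^'n) \<Rightarrow>
   (('m, 'n) chart \<Rightarrow> 'm \<Rightarrow> real^'n^'n) \<Rightarrow> bool" where
  "killing_on \<A> W g T \<longleftrightarrow>
     (\<forall>c\<in>\<A>. \<forall>p \<in> fst c \<inter> W.
        (\<forall>i j. T c p $ i $ j = T c p $ j $ i) \<and>
        (\<forall>i j k. cov_deriv g T c i j k p + cov_deriv g T c j k i p + cov_deriv g T c k i j p = 0))"

definition lower_index ::
  "(('m, 'n::finite) chart \<Rightarrow> 'm \<Rightarrow> real^'n^'n) \<Rightarrow> (('m, 'n) chart \<Rightarrow> 'm \<Rightarrow> real^'n^'n) \<Rightarrow>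
   ('m, 'n) chart \<Rightarrow> 'm \<Rightarrow> real^'n^'n" where
  "lower_index g K c p = (\<chi> i j. \<Sum>s\<in>UNIV. g c p $ s $ i * K c p $ s $ j)"

text \<open>The diagonalising coordinates are only required near each point of \<open>W\<close>.\<close>

definition generates_separation_on ::
  "('m, 'n::finite) chart set \<Rightarrow> 'm set \<Rightarrow> (('m, 'n) chart \<Rightarrow> 'm \<Rightarrow> real^'n^'n) \<Rightarrow>
   (('m, 'n) chart \<Rightarrow> 'm \<Rightarrow> real^'n^'n) \<Rightarrow> bool" where
  "generates_separation_on \<A> W g K \<longleftrightarrow>
     distinct_eigenvalues_on \<A> W K \<and>
     (\<forall>p\<in>W. \<exists>c\<in>\<A>. p \<in> fst c \<and> fst c \<subseteq> W \<and> diagonal_on c K) \<and>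
     killing_on \<A> W g (lower_index g K)"

end

theory Submission
  imports Defs
begin

text \<open>Write \<open>T = g K\<close>. On a velocity \<open>v\<close> the Killing equation for \<open>T\<close> is the vanishing of the cubic form
  \<open>C(v) = (D\<^sub>v T)(v, v) - 2 (D\<^sub>v g)(v, K v) + (D\<^bsub>K v\<^esub> g)(v, v)\<close>, which involves only first partial
  derivatives and does not depend on the coordinates. In coordinates diagonalising \<open>K\<close>, symmetry of \<open>T\<close>
  forces \<open>g\<close> to be diagonal, and \<open>C\<close> vanishes iff
  \<open>g\<^sub>i \<partial>\<^sub>k K\<^sub>i + (K\<^sub>k - K\<^sub>i) \<partial>\<^sub>k g\<^sub>i = 0\<close> for all \<open>i, k\<close>. For \<open>k = i\<close> this says that \<open>K\<close> is weakly nonlinear;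
  for \<open>k \<noteq> i\<close> it prescribes \<open>\<partial>\<^sub>k ln |g\<^sub>i| = - \<partial>\<^sub>k K\<^sub>i / (K\<^sub>k - K\<^sub>i)\<close>, whose integrability condition, with \<open>x\<^sub>i\<close> as
  a parameter, is the semi-hamiltonian equation. Conversely the Poincare lemma with parameters provides
  \<open>ln g\<^sub>i\<close>.\<close>

subsection \<open>Smooth functions\<close>

text \<open>The Killing equation is demanded in every chart, whereas the computation is feasible
  only in a diagonalising one. Transporting \<open>cov_deriv\<close> itself would require the
  transformation law of the Christoffel symbols. Since the inverse metric times T is K, the inverse
  metric drops out of every product of a Christoffel symbol with T; what remains is first order in g
  and T, and its invariance rests on the symmetry of the second derivatives of a coordinate change.
  Passing from the equation to the cubic form loses nothing, because a symmetric trilinear form is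
  determined by its values on the diagonal. In diagonalising coordinates the system decouples: for
  each i there is one unknown ln |g_i|, and all its partial derivatives except the i-th are
  prescribed. The solution is free up to a function of x_i, but it has to be smooth in x_i too, so
  solving separately on each leaf x_i = const would not be enough. The metric constructed this way
  is positive definite. A given metric may have any signature, so in the other direction ln |g_i| is
  present only through its derivatives, as quotients.\<close>

lemma Ck_on_cong_imp:
  assumes "open S" "\<And>x. x \<in> S \<Longrightarrow> f x = g x" "Ck_on k f S"
  shows "Ck_on k g S"
  using assms(2,3)
proof (induction k arbitrary: f g)
  case 0
  then show ?case using continuous_on_cong by fastforce
next
  case (Suc k)
  have fd: "frechet_derivative f (at x) = frechet_derivative g (at x)" if "x \<in> S" for x
    using frechet_derivative_transform_within_open Suc.prems \<open>open S\<close> that by (metis Ck_on.simps(2))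
  have "g differentiable (at x)" if "x \<in> S" for x
    by (meson Suc.prems Ck_on.simps(2) \<open>open S\<close> differentiable_def
        has_derivative_transform_within_open that)
  moreover have "Ck_on k (\<lambda>x. frechet_derivative g (at x) v) S" for v
    using Suc.IH[of "\<lambda>x. frechet_derivative f (at x) v"] Suc.prems(2) fd by simp
  ultimately show ?case by simp
qed

lemma Ck_on_cong:
  assumes "open S" "\<And>x. x \<in> S \<Longrightarrow> f x = g x"
  shows "Ck_on k f S \<longleftrightarrow> Ck_on k g S"
  using Ck_on_cong_imp[of S f g] Ck_on_cong_imp[of S g f] assms by metis

lemma Ck_on_mono: "Ck_on k f S \<Longrightarrow> T \<subseteq> S \<Longrightarrow> Ck_on k f T"
  by (induction k arbitrary: f) (auto intro: continuous_on_subset)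

lemma Ck_on_Suc_imp: "Ck_on (Suc k) f S \<Longrightarrow> Ck_on k f S"
proof (induction k arbitrary: f)
  case 0
  then show ?case
    by (simp add: continuous_at_imp_continuous_on differentiable_imp_continuous_within)
next
  case (Suc k)
  then show ?case by (metis Ck_on.simps(2))
qed

text \<open>The recursion defining \<open>Ck_on\<close> speaks of \<open>frechet_derivative\<close>;
  this rule accepts instead any formula that the differentiation rules produce on \<open>S\<close>.
  Openness of \<open>S\<close> allows the replacement in all higher derivatives.\<close>

lemma Ck_on_SucI:
  assumes "open S" "\<And>x. x \<in> S \<Longrightarrow> (f has_derivative f' x) (at x)"
    and "\<And>v. Ck_on k (\<lambda>x. f' x v) S"
  shows "Ck_on (Suc k) f S"
proof -
  have "frechet_derivative f (at x) = f' x" if "x \<in> S" for x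
    using frechet_derivative_at[OF assms(2)[OF that]] by simp
  then have "Ck_on k (\<lambda>x. frechet_derivative f (at x) v) S" for v
    using Ck_on_cong_imp[OF assms(1) _ assms(3)[of v]] by simp
  then show ?thesis using assms(2) by (auto simp: differentiable_def)
qed

lemma Ck_on_has_derivative:
  "Ck_on (Suc k) f S \<Longrightarrow> x \<in> S \<Longrightarrow> (f has_derivative frechet_derivative f (at x)) (at x)"
  by (simp add: frechet_derivative_works)

lemma Ck_on_const: "open S \<Longrightarrow> Ck_on k (\<lambda>x. c) S"
proof (induction k arbitrary: c)
  case (Suc k)
  then show ?case by (intro Ck_on_SucI[where f' = "\<lambda>x v. 0"]) auto
qed auto

lemma Ck_on_add:
  assumes "open S" shows "Ck_on k f S \<Longrightarrow> Ck_on k g S \<Longrightarrow> Ck_on k (\<lambda>x. f x + g x) S"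
proof (induction k arbitrary: f g)
  case 0
  then show ?case by (auto intro: continuous_on_add)
next
  case (Suc k)
  show ?case
    by (rule Ck_on_SucI[OF assms
          has_derivative_add[OF Ck_on_has_derivative[OF Suc.prems(1)] Ck_on_has_derivative[OF Suc.prems(2)]]])
      (use Suc in auto)
qed

lemma (in bounded_linear) Ck_on_compose:
  assumes "open S" shows "Ck_on k g S \<Longrightarrow> Ck_on k (\<lambda>x. f (g x)) S"
proof (induction k arbitrary: g)
  case 0
  then show ?case by (auto intro: continuous_on)
next
  case (Suc k)
  show ?case
    by (rule Ck_on_SucI[OF assms has_derivative[OF Ck_on_has_derivative[OF Suc.prems]]])
      (use Suc in auto)
qed

lemma (in bounded_bilinear) Ck_on_prod:
  assumes "open S" shows "Ck_on k f S \<Longrightarrow> Ck_on k g S \<Longrightarrow> Ck_on k (\<lambda>x. prod (f x) (g x)) S"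
proof (induction k arbitrary: f g)
  case 0
  then show ?case by (auto intro: continuous_on)
next
  case (Suc k)
  show ?case
    by (rule Ck_on_SucI[OF assms
          FDERIV[OF Ck_on_has_derivative[OF Suc.prems(1)] Ck_on_has_derivative[OF Suc.prems(2)]]])
      (use Suc Ck_on_Suc_imp[OF Suc.prems(1)] Ck_on_Suc_imp[OF Suc.prems(2)] in \<open>auto intro!: Ck_on_add[OF assms]\<close>)
qed

lemma Ck_on_sum:
  assumes "open S" "\<And>i. i \<in> I \<Longrightarrow> Ck_on k (f i) S"
  shows "Ck_on k (\<lambda>x. \<Sum>i\<in>I. f i x) S"
  using assms(2)
  by (induction I rule: infinite_finite_induct) (auto intro: Ck_on_const Ck_on_add assms(1))

lemma Ck_on_ident:
  assumes "open S" shows "Ck_on k (\<lambda>x. x) S"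
proof (cases k)
  case (Suc m)
  have "Ck_on (Suc m) (\<lambda>x. x) S"
    by (intro Ck_on_SucI[OF assms has_derivative_ident] Ck_on_const assms)
  then show ?thesis using Suc by simp
qed auto

text \<open>In the chain rule the derivative of \<open>f\<close> at \<open>g x\<close> is applied to
  a vector that itself varies with \<open>x\<close>, while \<open>Ck_on\<close> controls derivatives
  in fixed directions only. Expanding that vector over \<open>Basis\<close> separates the two
  dependences, which is why the middle space is Euclidean.\<close>

lemma Ck_on_compose:
  fixes g :: "'a::real_normed_vector \<Rightarrow> 'b::euclidean_space"
  assumes "open S" "\<And>x. x \<in> S \<Longrightarrow> g x \<in> T"
  shows "Ck_on k g S \<Longrightarrow> Ck_on k f T \<Longrightarrow> Ck_on k (\<lambda>x. f (g x)) S"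
proof (induction k arbitrary: f)
  case 0
  then show ?case using assms(2) by (auto intro: continuous_on_compose2)
next
  case (Suc k)
  let ?f' = "\<lambda>x v. \<Sum>b\<in>Basis. (frechet_derivative g (at x) v \<bullet> b) *\<^sub>R frechet_derivative f (at (g x)) b"
  have eq: "frechet_derivative f (at (g x)) w = (\<Sum>b\<in>Basis. (w \<bullet> b) *\<^sub>R frechet_derivative f (at (g x)) b)"
    if "x \<in> S" for x w
  proof -
    have "linear (frechet_derivative f (at (g x)))"
      using Suc.prems(2) assms(2)[OF that] by (simp add: linear_frechet_derivative)
    then show ?thesis
      by (subst euclidean_representation[of w, symmetric]) (simp add: linear_sum linear_scale)
  qed
  show ?case
  proof (rule Ck_on_SucI[OF assms(1)])
    show "((\<lambda>x. f (g x)) has_derivative ?f' x) (at x)" if "x \<in> S" for x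
      using has_derivative_compose[OF Ck_on_has_derivative[OF Suc.prems(1) that]
          Ck_on_has_derivative[OF Suc.prems(2) assms(2)[OF that]]]
      by (simp add: eq[OF that, symmetric])
    show "Ck_on k (\<lambda>x. ?f' x v) S" for v
    proof (intro Ck_on_sum assms(1) bounded_bilinear.Ck_on_prod[OF bounded_bilinear_scaleR])
      fix b :: 'b assume "b \<in> Basis"
      show "Ck_on k (\<lambda>x. frechet_derivative g (at x) v \<bullet> b) S"
        using bounded_linear.Ck_on_compose[OF bounded_linear_inner_left assms(1),
            of k "\<lambda>x. frechet_derivative g (at x) v"] Suc.prems(1) by simp
      show "Ck_on k (\<lambda>x. frechet_derivative f (at (g x)) b) S"
        by (rule Suc.IH[OF Ck_on_Suc_imp[OF Suc.prems(1)]]) (use Suc.prems(2) in simp)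
    qed
  qed
qed

lemma Ck_on_minus: "open S \<Longrightarrow> Ck_on k f S \<Longrightarrow> Ck_on k (\<lambda>x. - f x) S"
  by (rule bounded_linear.Ck_on_compose[OF bounded_linear_minus[OF bounded_linear_ident]])

text \<open>The derivative of 1/f is a product of two copies of 1/f and the derivative of f, so the
  induction feeds on its own hypothesis one order lower. The exponential below behaves in the same
  way.\<close>

lemma Ck_on_inverse:
  fixes f :: "'a::real_normed_vector \<Rightarrow> real"
  assumes "open S" "\<And>x. x \<in> S \<Longrightarrow> f x \<noteq> 0"
  shows "Ck_on k f S \<Longrightarrow> Ck_on k (\<lambda>x. inverse (f x)) S"
proof (induction k)
  case 0
  then show ?case using assms(2) by (auto intro!: continuous_on_inverse)
next
  case (Suc k)
  have IH: "Ck_on k (\<lambda>x. inverse (f x)) S" using Suc Ck_on_Suc_imp by blast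
  note mult = bounded_bilinear.Ck_on_prod[OF bounded_bilinear_mult assms(1)]
  show ?case
    by (rule Ck_on_SucI[OF assms(1)
          Deriv.has_derivative_inverse[OF assms(2) Ck_on_has_derivative[OF Suc.prems]]])
      (use Suc.prems IH in \<open>auto intro!: mult Ck_on_minus[OF assms(1)]\<close>)
qed

lemma Ck_on_exp:
  fixes f :: "'a::real_normed_vector \<Rightarrow> real"
  assumes "open S"
  shows "Ck_on k f S \<Longrightarrow> Ck_on k (\<lambda>x. exp (f x)) S"
proof (induction k)
  case 0
  then show ?case by (auto intro!: continuous_on_exp)
next
  case (Suc k)
  have IH: "Ck_on k (\<lambda>x. exp (f x)) S" using Suc Ck_on_Suc_imp by blast
  note mult = bounded_bilinear.Ck_on_prod[OF bounded_bilinear_mult assms(1)]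
  show ?case
    by (rule Ck_on_SucI[OF assms(1) has_derivative_exp[OF Ck_on_has_derivative[OF Suc.prems]]])
      (use Suc.prems IH in \<open>auto intro!: mult\<close>)
qed

section \<open>Closure properties of smooth functions\<close>

lemma smooth_on_cong: "open S \<Longrightarrow> (\<And>x. x \<in> S \<Longrightarrow> f x = g x) \<Longrightarrow> smooth_on f S \<longleftrightarrow> smooth_on g S"
  using Ck_on_cong unfolding smooth_on_def by blast

lemma smooth_on_subset: "smooth_on f S \<Longrightarrow> T \<subseteq> S \<Longrightarrow> smooth_on f T"
  using Ck_on_mono unfolding smooth_on_def by blast

lemma smooth_on_has_derivative:
  "smooth_on f S \<Longrightarrow> x \<in> S \<Longrightarrow> (f has_derivative frechet_derivative f (at x)) (at x)"
  using Ck_on_has_derivative unfolding smooth_on_def by blast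

lemma smooth_on_frechet_derivative:
  "smooth_on f S \<Longrightarrow> smooth_on (\<lambda>x. frechet_derivative f (at x) v) S"
  unfolding smooth_on_def by (metis Ck_on.simps(2))

lemma smooth_on_differentiable: "smooth_on f S \<Longrightarrow> x \<in> S \<Longrightarrow> f differentiable (at x)"
  using smooth_on_has_derivative differentiable_def by blast

lemma smooth_on_continuous: "smooth_on f S \<Longrightarrow> continuous_on S f"
  unfolding smooth_on_def by (metis Ck_on.simps(1))

lemma smooth_on_const: "open S \<Longrightarrow> smooth_on (\<lambda>x. c) S"
  and smooth_on_ident: "open S \<Longrightarrow> smooth_on (\<lambda>x. x) S"
  and smooth_on_add: "open S \<Longrightarrow> smooth_on f S \<Longrightarrow> smooth_on h S \<Longrightarrow> smooth_on (\<lambda>x. f x + h x) S"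
  and smooth_on_bounded_linear: "bounded_linear L \<Longrightarrow> open S \<Longrightarrow> smooth_on f S \<Longrightarrow> smooth_on (\<lambda>x. L (f x)) S"
  and smooth_on_bounded_bilinear:
    "bounded_bilinear B \<Longrightarrow> open S \<Longrightarrow> smooth_on f S \<Longrightarrow> smooth_on h' S \<Longrightarrow> smooth_on (\<lambda>x. B (f x) (h' x)) S"
  and smooth_on_sum:
    "open S \<Longrightarrow> (\<And>i. i \<in> I \<Longrightarrow> smooth_on (F i) S) \<Longrightarrow> smooth_on (\<lambda>x. \<Sum>i\<in>I. F i x) S"
  by (auto simp: smooth_on_def Ck_on_const Ck_on_ident Ck_on_add bounded_linear.Ck_on_compose
      bounded_bilinear.Ck_on_prod intro: Ck_on_sum)

lemma smooth_on_mult: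
  fixes f g :: "'a::real_normed_vector \<Rightarrow> real"
  assumes "open S" "smooth_on f S" "smooth_on g S"
  shows "smooth_on (\<lambda>x. f x * g x) S"
  by (rule smooth_on_bounded_bilinear[OF bounded_bilinear_mult assms])

lemma smooth_on_minus: "open S \<Longrightarrow> smooth_on f S \<Longrightarrow> smooth_on (\<lambda>x. - f x) S"
  by (rule smooth_on_bounded_linear[OF bounded_linear_minus[OF bounded_linear_ident]])

lemma smooth_on_diff:
  assumes "open S" "smooth_on f S" "smooth_on g S"
  shows "smooth_on (\<lambda>x. f x - g x) S"
  using smooth_on_add[OF assms(1,2) smooth_on_minus[OF assms(1,3)]] by simp

lemma smooth_on_compose:
  fixes g :: "'a::real_normed_vector \<Rightarrow> 'b::euclidean_space"
  shows "open S \<Longrightarrow> smooth_on g S \<Longrightarrow> smooth_on f T \<Longrightarrow> (\<And>x. x \<in> S \<Longrightarrow> g x \<in> T)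
    \<Longrightarrow> smooth_on (\<lambda>x. f (g x)) S"
  using Ck_on_compose unfolding smooth_on_def by blast

lemma smooth_on_inverse:
  fixes f :: "'a::real_normed_vector \<Rightarrow> real"
  shows "open S \<Longrightarrow> smooth_on f S \<Longrightarrow> (\<And>x. x \<in> S \<Longrightarrow> f x \<noteq> 0) \<Longrightarrow> smooth_on (\<lambda>x. inverse (f x)) S"
  using Ck_on_inverse unfolding smooth_on_def by blast

lemma smooth_on_exp:
  fixes f :: "'a::real_normed_vector \<Rightarrow> real"
  shows "open S \<Longrightarrow> smooth_on f S \<Longrightarrow> smooth_on (\<lambda>x. exp (f x)) S"
  using Ck_on_exp unfolding smooth_on_def by blast

lemma bounded_linear_axis: "bounded_linear (axis i :: 'a::real_normed_vector \<Rightarrow> 'a^'n::finite)"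
  by (rule bounded_linear_intro[of _ 1])
    (auto simp: vec_eq_iff axis_def norm_vec_def L2_set_def if_distrib if_distribR cong: if_cong)

lemma smooth_on_vec_lambda:
  fixes f :: "'i::finite \<Rightarrow> 'a::real_normed_vector \<Rightarrow> 'b::real_normed_vector"
  assumes "open S" "\<And>i. smooth_on (f i) S"
  shows "smooth_on (\<lambda>x. \<chi> i. f i x) S"
proof -
  have "(\<lambda>x. \<chi> i. f i x) = (\<lambda>x. \<Sum>i\<in>UNIV. axis i (f i x))"
    by (auto simp: vec_eq_iff axis_def fun_eq_iff)
  then show ?thesis
    using assms by (auto intro!: smooth_on_sum smooth_on_bounded_linear[OF bounded_linear_axis])
qed

lemma smooth_on_vec_nth: "open S \<Longrightarrow> smooth_on f S \<Longrightarrow> smooth_on (\<lambda>x. f x $ i) S"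
  by (rule smooth_on_bounded_linear[OF bounded_linear_vec_nth])

subsection \<open>Second derivatives and parametric integrals\<close>

text \<open>The mean value theorem is applied twice, along \<open>v\<close> to the increment in
  \<open>w\<close> and along \<open>w\<close> to the resulting difference of derivatives. The left
  side of the equation is symmetric in \<open>v\<close> and \<open>w\<close> while the mixed
  derivative on the right is not yet known to be; this asymmetry is exploited next.\<close>

lemma second_difference_mean_value:
  fixes f :: "'a::euclidean_space \<Rightarrow> real"
  assumes sm: "smooth_on f S" and "h > 0"
    and sub: "\<And>s t. 0 \<le> s \<Longrightarrow> s \<le> h \<Longrightarrow> 0 \<le> t \<Longrightarrow> t \<le> h \<Longrightarrow> x + s *\<^sub>R v + t *\<^sub>R w \<in> S"
  obtains s t where "0 < s" "s < h" "0 < t" "t < h"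
    "f (x + h *\<^sub>R v + h *\<^sub>R w) - f (x + h *\<^sub>R v) - f (x + h *\<^sub>R w) + f x
      = h * (h * frechet_derivative (\<lambda>y. frechet_derivative f (at y) v) (at (x + s *\<^sub>R v + t *\<^sub>R w)) w)"
proof -
  let ?D = "\<lambda>y. frechet_derivative f (at y) v"
  have d1: "((\<lambda>s. f (x + s *\<^sub>R v + h *\<^sub>R w) - f (x + s *\<^sub>R v)) has_real_derivative
      (?D (x + s *\<^sub>R v + h *\<^sub>R w) - ?D (x + s *\<^sub>R v))) (at s)" if "0 \<le> s" "s \<le> h" for s
  proof -
    have "((\<lambda>s. f (x + s *\<^sub>R v + t *\<^sub>R w)) has_real_derivative ?D (x + s *\<^sub>R v + t *\<^sub>R w)) (at s)"
      if "0 \<le> t" "t \<le> h" for t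
    proof -
      have "((\<lambda>s. x + s *\<^sub>R v + t *\<^sub>R w) has_derivative (\<lambda>r. r *\<^sub>R v)) (at s)"
        by (auto intro!: derivative_eq_intros)
      from has_derivative_compose[OF this smooth_on_has_derivative[OF sm sub]]
      have "((\<lambda>s. f (x + s *\<^sub>R v + t *\<^sub>R w)) has_derivative
          (\<lambda>r. frechet_derivative f (at (x + s *\<^sub>R v + t *\<^sub>R w)) (r *\<^sub>R v))) (at s)"
        using that \<open>0 \<le> s\<close> \<open>s \<le> h\<close> by blast
      moreover have "linear (frechet_derivative f (at (x + s *\<^sub>R v + t *\<^sub>R w)))"
        using smooth_on_differentiable[OF sm sub] that \<open>0 \<le> s\<close> \<open>s \<le> h\<close>
        by (intro linear_frechet_derivative) blast
      ultimately show ?thesis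
        by (simp add: has_field_derivative_def linear_scale mult_commute_abs)
    qed
    from this[of h] this[of 0] \<open>h > 0\<close> show ?thesis by (auto intro!: DERIV_diff)
  qed
  obtain s where s: "0 < s" "s < h" and
    eq1: "(f (x + h *\<^sub>R v + h *\<^sub>R w) - f (x + h *\<^sub>R v)) - (f (x + h *\<^sub>R w) - f x)
      = h * (?D (x + s *\<^sub>R v + h *\<^sub>R w) - ?D (x + s *\<^sub>R v))"
    using MVT2[OF \<open>h > 0\<close> d1] by auto
  have d2: "((\<lambda>t. ?D (x + s *\<^sub>R v + t *\<^sub>R w)) has_real_derivative
     (frechet_derivative ?D (at (x + s *\<^sub>R v + t *\<^sub>R w)) w)) (at t)" if "0 \<le> t" "t \<le> h" for t
  proof -
    have *: "((\<lambda>t. x + s *\<^sub>R v + t *\<^sub>R w) has_derivative (\<lambda>r. r *\<^sub>R w)) (at t)"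
      by (auto intro!: derivative_eq_intros)
    have sD: "smooth_on ?D S" by (rule smooth_on_frechet_derivative[OF sm])
    have "x + s *\<^sub>R v + t *\<^sub>R w \<in> S" using sub that s by simp
    from has_derivative_compose[OF * smooth_on_has_derivative[OF sD this]]
      linear_frechet_derivative[OF smooth_on_differentiable[OF sD this]]
    show ?thesis
      by (simp add: has_field_derivative_def linear_scale mult_commute_abs)
  qed
  obtain t where "0 < t" "t < h" and
    eq2: "?D (x + s *\<^sub>R v + h *\<^sub>R w) - ?D (x + s *\<^sub>R v)
      = h * (frechet_derivative ?D (at (x + s *\<^sub>R v + t *\<^sub>R w)) w)"
    using MVT2[OF \<open>h > 0\<close> d2] by auto
  show ?thesis
    by (rule that[OF s \<open>0 < t\<close> \<open>t < h\<close>]) (use eq1 eq2 in simp)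
qed

text \<open>Both mixed derivatives, taken at suitable points near \<open>x\<close>, equal the same
  second difference divided by h^2. Were they different at \<open>x\<close>, continuity would keep
  each within half the gap of its own limit, and they could not coincide.\<close>

lemma second_derivative_symmetric_real:
  fixes f :: "'a::euclidean_space \<Rightarrow> real"
  assumes sm: "smooth_on f S" and "open S" "x \<in> S"
  shows "frechet_derivative (\<lambda>y. frechet_derivative f (at y) v) (at x) w
       = frechet_derivative (\<lambda>y. frechet_derivative f (at y) w) (at x) v" (is "?A x = ?B x")
proof (rule ccontr)
  assume ne: "?A x \<noteq> ?B x"
  define e where "e = \<bar>?A x - ?B x\<bar> / 2"
  have "e > 0" using ne by (simp add: e_def)
  have "continuous_on S ?A" "continuous_on S ?B"
    by (intro smooth_on_continuous smooth_on_frechet_derivative sm)+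
  then have "isCont ?A x" "isCont ?B x"
    using \<open>open S\<close> \<open>x \<in> S\<close> continuous_on_eq_continuous_at by blast+
  then have lim: "(?A \<longlongrightarrow> ?A x) (nhds x)" "(?B \<longlongrightarrow> ?B x) (nhds x)"
    using tendsto_at_iff_tendsto_nhds[of ?A x] tendsto_at_iff_tendsto_nhds[of ?B x]
    by (simp_all add: isCont_def)
  have "\<forall>\<^sub>F y in nhds x. dist (?A y) (?A x) < e \<and> dist (?B y) (?B x) < e \<and> y \<in> S"
    by (intro eventually_conj tendstoD[OF lim(1)] tendstoD[OF lim(2)] \<open>e > 0\<close>
        eventually_nhds_in_open assms)
  then obtain d where "d > 0" and
    d: "\<And>y. dist y x < d \<Longrightarrow> dist (?A y) (?A x) < e \<and> dist (?B y) (?B x) < e \<and> y \<in> S"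
    unfolding eventually_nhds_metric by blast
  \<comment> \<open>This size keeps the whole parallelogram spanned by \<open>h *\<^sub>R v\<close>
    and \<open>h *\<^sub>R w\<close> in the ball of radius \<open>d\<close>; the summand 1 makes the
    estimate strict and covers vanishing \<open>v\<close> and \<open>w\<close>.\<close>
  define h where "h = d / (norm v + norm w + 1)"
  have pos: "norm v + norm w + 1 > 0" by (smt (verit) norm_ge_zero)
  then have "h > 0" using \<open>d > 0\<close> by (simp add: h_def)
  have near: "dist (x + s *\<^sub>R v + t *\<^sub>R w) x < d" "dist (x + t *\<^sub>R w + s *\<^sub>R v) x < d"
    if "0 \<le> s" "s \<le> h" "0 \<le> t" "t \<le> h" for s t
  proof -
    have "norm (s *\<^sub>R v + t *\<^sub>R w) \<le> s * norm v + t * norm w"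
      using norm_triangle_ineq[of "s *\<^sub>R v" "t *\<^sub>R w"] that by simp
    also have "\<dots> \<le> h * norm v + h * norm w"
      using that by (intro add_mono mult_right_mono) auto
    also have "\<dots> < h * (norm v + norm w + 1)"
      using \<open>h > 0\<close> by (simp add: algebra_simps)
    also have "\<dots> = d" using pos by (simp add: h_def)
    finally show "dist (x + s *\<^sub>R v + t *\<^sub>R w) x < d" "dist (x + t *\<^sub>R w + s *\<^sub>R v) x < d"
      by (simp_all add: dist_norm algebra_simps)
  qed
  obtain s t where st: "0 < s" "s < h" "0 < t" "t < h"
    and 1: "f (x + h *\<^sub>R v + h *\<^sub>R w) - f (x + h *\<^sub>R v) - f (x + h *\<^sub>R w) + f x
      = h * (h * ?A (x + s *\<^sub>R v + t *\<^sub>R w))"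
    using second_difference_mean_value[OF sm \<open>h > 0\<close>, of x v w] near d by metis
  obtain s' t' where st': "0 < s'" "s' < h" "0 < t'" "t' < h"
    and 2: "f (x + h *\<^sub>R w + h *\<^sub>R v) - f (x + h *\<^sub>R w) - f (x + h *\<^sub>R v) + f x
      = h * (h * ?B (x + s' *\<^sub>R w + t' *\<^sub>R v))"
    using second_difference_mean_value[OF sm \<open>h > 0\<close>, of x w v] near d by metis
  have "?A (x + s *\<^sub>R v + t *\<^sub>R w) = ?B (x + s' *\<^sub>R w + t' *\<^sub>R v)"
    using 1 2 \<open>h > 0\<close> by (simp add: algebra_simps)
  moreover have "dist (?A (x + s *\<^sub>R v + t *\<^sub>R w)) (?A x) < e"
    using near[of s t] st d by simp
  moreover have "dist (?B (x + s' *\<^sub>R w + t' *\<^sub>R v)) (?B x) < e"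
    using near[of t' s'] st' d by simp
  moreover have "\<not> (dist a c < \<bar>c - d\<bar> / 2 \<and> dist a d < \<bar>c - d\<bar> / 2)" for a c d :: real
    using dist_triangle3[of c d a] by (auto simp: dist_real_def)
  ultimately show False unfolding e_def by metis
qed

lemma frechet_derivative_inner_left:
  assumes "f differentiable (at x)"
  shows "frechet_derivative (\<lambda>y. f y \<bullet> b) (at x) v = frechet_derivative f (at x) v \<bullet> b"
  using frechet_derivative_at[OF has_derivative_inner_left[OF
      assms[unfolded frechet_derivative_works], of b]] by metis

lemma second_derivative_symmetric:
  fixes f :: "'a::euclidean_space \<Rightarrow> 'b::euclidean_space"
  assumes sm: "smooth_on f S" and "open S" "x \<in> S"
  shows "frechet_derivative (\<lambda>y. frechet_derivative f (at y) v) (at x) w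
       = frechet_derivative (\<lambda>y. frechet_derivative f (at y) w) (at x) v"
proof (rule euclidean_eqI)
  fix b :: 'b assume "b \<in> Basis"
  have comp: "frechet_derivative (\<lambda>y. frechet_derivative f (at y) v) (at x) w \<bullet> b =
     frechet_derivative (\<lambda>y. frechet_derivative (\<lambda>z. f z \<bullet> b) (at y) v) (at x) w" for v w
  proof -
    have "frechet_derivative (\<lambda>y. frechet_derivative (\<lambda>z. f z \<bullet> b) (at y) v) (at x)
      = frechet_derivative (\<lambda>y. frechet_derivative f (at y) v \<bullet> b) (at x)"
    proof (rule frechet_derivative_transform_within_open[OF _ \<open>open S\<close> \<open>x \<in> S\<close>])
      show "(\<lambda>y. frechet_derivative (\<lambda>z. f z \<bullet> b) (at y) v) differentiable at x"
        by (intro smooth_on_differentiable[OF smooth_on_frechet_derivative \<open>x \<in> S\<close>]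
            smooth_on_bounded_linear[OF bounded_linear_inner_left] assms)
    qed (simp add: frechet_derivative_inner_left smooth_on_differentiable[OF sm])
    then show ?thesis
      by (simp add: frechet_derivative_inner_left
          smooth_on_differentiable[OF smooth_on_frechet_derivative[OF sm] \<open>x \<in> S\<close>])
  qed
  have "smooth_on (\<lambda>z. f z \<bullet> b) S"
    by (intro smooth_on_bounded_linear[OF bounded_linear_inner_left] assms)
  from second_derivative_symmetric_real[OF this assms(2,3)]
  show "frechet_derivative (\<lambda>y. frechet_derivative f (at y) v) (at x) w \<bullet> b
      = frechet_derivative (\<lambda>y. frechet_derivative f (at y) w) (at x) v \<bullet> b"
    by (simp add: comp)
qed

text \<open>Differentiation under the integral sign. Smoothness is asked on a set \<open>S\<close>
  around the product because \<open>{0..1} \<times> U\<close> is not open, and two-sided derivatives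
  are required also at the end points of the interval.\<close>

lemma has_derivative_parametric_integral:
  fixes h :: "real \<times> 'a::euclidean_space \<Rightarrow> real"
  assumes sm: "smooth_on h S" and "open U" "{0..1} \<times> U \<subseteq> S" "x \<in> U"
  shows "((\<lambda>x. integral {0..1} (\<lambda>t. h (t, x))) has_derivative
    (\<lambda>v. integral {0..1} (\<lambda>t. frechet_derivative h (at (t, x)) (0, v)))) (at x)"
proof -
  obtain e where "e > 0" and e: "ball x e \<subseteq> U"
    using \<open>open U\<close> \<open>x \<in> U\<close> open_contains_ball by blast
  let ?D = "\<lambda>y t v. frechet_derivative h (at (t, y)) (0, v)"
  have D: "((\<lambda>y. h (t, y)) has_derivative ?D y t) (at y)" if "y \<in> U" "t \<in> {0..1}" for y t
  proof -
    have "((\<lambda>y. (t, y)) has_derivative (\<lambda>v. (0, v))) (at y)"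
      by (auto intro!: derivative_eq_intros)
    moreover have "(t, y) \<in> S" using that assms(3) by blast
    ultimately show ?thesis
      by (rule has_derivative_compose[OF _ smooth_on_has_derivative[OF sm]])
  qed
  have Da: "blinfun_apply (Blinfun (?D y t)) = ?D y t" if "y \<in> U" "t \<in> {0..1}" for y t
    using has_derivative_bounded_linear[OF D[OF that]] by (simp add: bounded_linear_Blinfun_apply)
  have contD: "continuous_on (U \<times> {0..1}) (\<lambda>(y, t). ?D y t v)" for v
  proof -
    have "continuous_on S (\<lambda>z. frechet_derivative h (at z) (0, v))"
      by (intro smooth_on_continuous smooth_on_frechet_derivative sm)
    then have "continuous_on (U \<times> {0..1}) (\<lambda>z. frechet_derivative h (at (snd z, fst z)) (0, v))"
      by (rule continuous_on_compose2) (use assms(3) in \<open>auto intro!: continuous_intros\<close>)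
    then show ?thesis by (simp add: case_prod_beta)
  qed
  \<comment> \<open>The Leibniz rule needs the derivative to be continuous in operator norm; in
    finite dimension it is enough to test it on the basis vectors.\<close>
  have contB: "continuous_on (ball x e \<times> {0..1}) (\<lambda>(y, t). Blinfun (?D y t))"
  proof (rule continuous_on_blinfun_componentwise)
    fix i :: 'a assume "i \<in> Basis"
    have "continuous_on (ball x e \<times> {0..1}) (\<lambda>(y, t). ?D y t i)"
      by (rule continuous_on_subset[OF contD]) (use e in auto)
    then show "continuous_on (ball x e \<times> {0..1}) (\<lambda>z. blinfun_apply (case z of (y, t) \<Rightarrow> Blinfun (?D y t)) i)"
      by (rule continuous_on_cong[THEN iffD1, rotated -1]) (use Da e in auto)
  qed
  have cont: "continuous_on {0..1} (\<lambda>t. h (t, y))" if "y \<in> U" for y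
    by (rule continuous_on_compose2[OF smooth_on_continuous[OF sm]])
      (use that assms(3) in \<open>auto intro!: continuous_intros\<close>)
  have "((\<lambda>x. integral (cbox 0 1) (\<lambda>t. h (t, x))) has_derivative
      blinfun_apply (integral (cbox 0 1) (\<lambda>t. Blinfun (?D x t)))) (at x within ball x e)"
  proof (rule leibniz_rule[where fx = "\<lambda>y t. Blinfun (?D y t)"])
    show "((\<lambda>x. h (t, x)) has_derivative blinfun_apply (Blinfun (?D y t))) (at y within ball x e)"
      if "y \<in> ball x e" "t \<in> cbox 0 1" for y t
    proof -
      have "y \<in> U" "t \<in> {0..1}" using that e by auto
      then show ?thesis using D[of y t] Da[of y t] has_derivative_at_withinI by metis
    qed
    show "(\<lambda>t. h (t, y)) integrable_on cbox 0 1" if "y \<in> ball x e" for y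
      using integrable_continuous_interval[OF cont[of y]] that e by auto
    show "continuous_on (ball x e \<times> cbox 0 1) (\<lambda>(y, t). Blinfun (?D y t))"
      using contB by simp
  qed (use \<open>e > 0\<close> in auto)
  moreover have "at x within ball x e = at x"
    by (rule at_within_open) (use \<open>e > 0\<close> in auto)
  moreover have "blinfun_apply (integral {0..1} (\<lambda>t. Blinfun (?D x t))) = (\<lambda>v. integral {0..1} (\<lambda>t. ?D x t v))"
  proof
    fix v
    have "continuous_on {0..1} (\<lambda>t. Blinfun (?D x t))"
    proof -
      have "continuous_on {0..1} (\<lambda>t. case (x, t) of (y, t) \<Rightarrow> Blinfun (?D y t))"
        by (rule continuous_on_compose2[OF contB]) (use \<open>e > 0\<close> in \<open>auto intro!: continuous_intros\<close>)
      then show ?thesis by simp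
    qed
    then have "(\<lambda>t. Blinfun (?D x t)) integrable_on {0..1}"
      by (rule integrable_continuous_interval)
    then have "blinfun_apply (integral {0..1} (\<lambda>t. Blinfun (?D x t))) v
        = integral {0..1} (\<lambda>t. blinfun_apply (Blinfun (?D x t)) v)"
      by (rule blinfun_apply_integral)
    also have "\<dots> = integral {0..1} (\<lambda>t. ?D x t v)"
      using Da[OF \<open>x \<in> U\<close>] by (intro Henstock_Kurzweil_Integration.integral_cong) simp
    finally show "blinfun_apply (integral {0..1} (\<lambda>t. Blinfun (?D x t))) v = integral {0..1} (\<lambda>t. ?D x t v)" .
  qed
  ultimately show ?thesis by simp
qed

text \<open>Each derivative of the integral is again an integral of the same kind, with
  \<open>h\<close> replaced by its derivative in a direction \<open>(0, v)\<close>. Hence the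
  induction has to leave \<open>h\<close> arbitrary.\<close>

lemma smooth_on_parametric_integral:
  fixes h :: "real \<times> 'a::euclidean_space \<Rightarrow> real"
  assumes "smooth_on h S" "open U" "{0..1} \<times> U \<subseteq> S"
  shows "smooth_on (\<lambda>x. integral {0..1} (\<lambda>t. h (t, x))) U"
  unfolding smooth_on_def
proof
  fix k
  show "Ck_on k (\<lambda>x. integral {0..1} (\<lambda>t. h (t, x))) U"
    using assms(1)
  proof (induction k arbitrary: h)
    case 0
    then show ?case
      by (simp add: continuous_at_imp_continuous_on
          has_derivative_continuous[OF has_derivative_parametric_integral[OF 0 assms(2,3)]])
  next
    case (Suc k)
    show ?case
      by (rule Ck_on_SucI[OF \<open>open U\<close> has_derivative_parametric_integral[OF Suc.prems assms(2,3)]])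
        (assumption, rule Suc.IH[OF smooth_on_frechet_derivative[OF Suc.prems]])
  qed
qed

subsection \<open>The Poincare lemma with parameters\<close>

text \<open>Only the leaves parallel to the range of \<open>P\<close> matter. The primitive is the integral along the
  straight segments in the leaves that start on the complementary subspace through \<open>x0\<close>.\<close>

lemma poincare_along_projection:
  fixes \<omega> :: "'a::euclidean_space \<Rightarrow> 'a" and P :: "'a \<Rightarrow> 'a"
  assumes sm: "smooth_on \<omega> (ball x0 r)" and P: "bounded_linear P"
    and idem: "\<And>v. P (P v) = P v" and contr: "\<And>v. norm (v - P v) \<le> norm v"
    and closed: "\<And>x v w. x \<in> ball x0 r \<Longrightarrow>
      frechet_derivative \<omega> (at x) (P v) \<bullet> P w = frechet_derivative \<omega> (at x) (P w) \<bullet> P v"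
  obtains f where "smooth_on f (ball x0 r)"
    "\<And>x v. x \<in> ball x0 r \<Longrightarrow> frechet_derivative f (at x) (P v) = \<omega> x \<bullet> P v"
proof -
  interpret P: bounded_linear P by fact
  \<comment> \<open>The segment ends at \<open>x\<close> for t = 1 and starts for t = 0 at the point
    of the leaf of \<open>x\<close> whose displacement from \<open>x0\<close> has no
    \<open>P\<close>-part. It is defined for all real \<open>t\<close>, so that \<open>S\<close> is
    an open set containing the product.\<close>
  define z where "z = (\<lambda>(t::real, x). x - (1 - t) *\<^sub>R P (x - x0))"
  define S where "S = z -` ball x0 r"
  have sfst: "smooth_on (\<lambda>y::real \<times> 'a. fst y) UNIV" and ssnd: "smooth_on (\<lambda>y::real \<times> 'a. snd y) UNIV"
    by (rule smooth_on_bounded_linear[OF bounded_linear_fst open_UNIV smooth_on_ident[OF open_UNIV]],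
        rule smooth_on_bounded_linear[OF bounded_linear_snd open_UNIV smooth_on_ident[OF open_UNIV]])
  have sPU: "smooth_on (\<lambda>y::real \<times> 'a. P (snd y - x0)) UNIV"
    by (intro smooth_on_bounded_linear[OF P] smooth_on_diff smooth_on_const ssnd open_UNIV)
  have zU: "smooth_on z UNIV"
    unfolding z_def case_prod_beta
    by (intro smooth_on_diff ssnd open_UNIV smooth_on_bounded_bilinear[OF bounded_bilinear_scaleR]
        smooth_on_const sfst sPU)
  have "open S" unfolding S_def
    by (rule open_vimage) (use smooth_on_continuous[OF zU] in auto)
  \<comment> \<open>The integrand is \<omega> evaluated on the constant velocity
    \<open>P (x - x0)\<close> of the segment.\<close>
  define h where "h = (\<lambda>y. \<omega> (z y) \<bullet> P (snd y - x0))"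
  have smh: "smooth_on h S"
    unfolding h_def
    by (intro smooth_on_bounded_bilinear[OF bounded_bilinear_inner] \<open>open S\<close>
        smooth_on_compose[OF \<open>open S\<close> smooth_on_subset[OF zU] sm] smooth_on_subset[OF sPU])
      (auto simp: S_def)
  \<comment> \<open>With u = x - x0, the displacement of z from \<open>x0\<close> is a convex
    combination of u and u - P u. By \<open>contr\<close> neither is longer than u, so the segment
    stays in the ball.\<close>
  have sub: "{0..1} \<times> ball x0 r \<subseteq> S"
  proof (clarify)
    fix t :: real and x assume t: "t \<in> {0..1}" and x: "x \<in> ball x0 r"
    let ?u = "x - x0"
    have "z (t, x) - x0 = t *\<^sub>R ?u + (1 - t) *\<^sub>R (?u - P ?u)"
      by (simp add: z_def algebra_simps)
    then have "norm (z (t, x) - x0) \<le> norm (t *\<^sub>R ?u) + norm ((1 - t) *\<^sub>R (?u - P ?u))"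
      using norm_triangle_ineq by metis
    also have "\<dots> \<le> t * norm ?u + (1 - t) * norm ?u"
      using t contr[of ?u] by (intro add_mono) (auto simp: mult_left_mono)
    also have "\<dots> = norm ?u" by (simp add: algebra_simps)
    finally show "(t, x) \<in> S" using x by (simp add: S_def dist_norm norm_minus_commute)
  qed
  define f where "f = (\<lambda>x. integral {0..1} (\<lambda>t. h (t, x)))"
  have "smooth_on f (ball x0 r)"
    unfolding f_def by (rule smooth_on_parametric_integral[OF smh open_ball sub])
  moreover have "frechet_derivative f (at x) (P v) = \<omega> x \<bullet> P v" if x: "x \<in> ball x0 r" for x v
  proof -
    let ?u = "P (x - x0)"
    let ?D = "\<lambda>y. frechet_derivative \<omega> (at y)"
    have zin: "z (t, x) \<in> ball x0 r" if "t \<in> {0..1}" for t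
      using sub that x unfolding S_def by blast
    have lin: "linear (?D y)" if "y \<in> ball x0 r" for y
      using smooth_on_differentiable[OF sm that] by (rule linear_frechet_derivative)
    \<comment> \<open>Displacing \<open>x\<close> by \<open>P v\<close> displaces z by t times
      \<open>P v\<close>, because \<open>P\<close> is idempotent. Closedness along the leaf then
      exchanges \<open>P v\<close> with the velocity, and the right side becomes the t-derivative of
      t times \<omega> at z applied to \<open>P v\<close>.\<close>
    have dh: "frechet_derivative h (at (t, x)) (0, P v) = t * (?D (z (t, x)) ?u \<bullet> P v) + \<omega> (z (t, x)) \<bullet> P v"
      if t: "t \<in> {0..1}" for t
    proof -
      have 1: "((\<lambda>y. z (t, y)) has_derivative (\<lambda>w. w - (1 - t) *\<^sub>R P w)) (at x)"
        unfolding z_def prod.case by (auto intro!: derivative_eq_intros P.has_derivative)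
      have 2: "((\<lambda>y. P (y - x0)) has_derivative P) (at x)"
        by (auto intro!: derivative_eq_intros P.has_derivative)
      have dA: "((\<lambda>y. h (t, y)) has_derivative
        (\<lambda>w. \<omega> (z (t, x)) \<bullet> P w + ?D (z (t, x)) (w - (1 - t) *\<^sub>R P w) \<bullet> ?u)) (at x)"
        unfolding h_def snd_conv
        using has_derivative_inner[OF has_derivative_compose[OF 1
              smooth_on_has_derivative[OF sm zin[OF t]]] 2] .
      have dB: "((\<lambda>y. h (t, y)) has_derivative
        (\<lambda>w. frechet_derivative h (at (t, x)) (0, w))) (at x)"
      proof -
        have "((\<lambda>y. (t, y)) has_derivative (\<lambda>w. (0, w))) (at x)"
          by (auto intro!: derivative_eq_intros)
        moreover have "(t, x) \<in> S" using sub t x by blast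
        ultimately show ?thesis
          by (rule has_derivative_compose[OF _ smooth_on_has_derivative[OF smh]])
      qed
      have "frechet_derivative h (at (t, x)) (0, P v)
        = \<omega> (z (t, x)) \<bullet> P (P v) + ?D (z (t, x)) (P v - (1 - t) *\<^sub>R P (P v)) \<bullet> ?u"
        by (rule fun_cong[OF has_derivative_unique[OF dB dA]])
      also have "P v - (1 - t) *\<^sub>R P (P v) = t *\<^sub>R P v" by (simp add: idem algebra_simps)
      also have "?D (z (t, x)) (t *\<^sub>R P v) \<bullet> ?u = t * (?D (z (t, x)) ?u \<bullet> P v)"
        using closed[OF zin[OF t], of v "x - x0"] by (simp add: linear_scale[OF lin[OF zin[OF t]]])
      finally show ?thesis by (simp add: idem)
    qed
    \<comment> \<open>The factor t suppresses the contribution of the starting point, and at t = 1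
      the point z is \<open>x\<close>.\<close>
    have ftc: "((\<lambda>t. t * (?D (z (t, x)) ?u \<bullet> P v) + \<omega> (z (t, x)) \<bullet> P v) has_integral
        (1 * (\<omega> (z (1, x)) \<bullet> P v) - 0 * (\<omega> (z (0, x)) \<bullet> P v))) {0..1}"
    proof (rule fundamental_theorem_of_calculus)
      fix t :: real assume t: "t \<in> {0..1}"
      have 1: "((\<lambda>t. z (t, x)) has_derivative (\<lambda>s. s *\<^sub>R ?u)) (at t within {0..1})"
        unfolding z_def prod.case by (auto intro!: derivative_eq_intros)
      have "((\<lambda>t. \<omega> (z (t, x)) \<bullet> P v) has_derivative (\<lambda>s. ?D (z (t, x)) (s *\<^sub>R ?u) \<bullet> P v)) (at t within {0..1})"
        by (intro has_derivative_inner_left has_derivative_compose[OF 1]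
            smooth_on_has_derivative[OF sm zin[OF t]])
      then have "((\<lambda>t. \<omega> (z (t, x)) \<bullet> P v) has_vector_derivative (?D (z (t, x)) ?u \<bullet> P v)) (at t within {0..1})"
        by (simp add: has_vector_derivative_def linear_scale[OF lin[OF zin[OF t]]])
      from has_vector_derivative_mult[OF has_vector_derivative_id this]
      show "((\<lambda>t. t * (\<omega> (z (t, x)) \<bullet> P v)) has_vector_derivative
          t * (?D (z (t, x)) ?u \<bullet> P v) + \<omega> (z (t, x)) \<bullet> P v) (at t within {0..1})"
        by simp
    qed simp
    have "frechet_derivative f (at x) (P v) = integral {0..1} (\<lambda>t. frechet_derivative h (at (t, x)) (0, P v))"
      unfolding f_def
      using frechet_derivative_at[OF has_derivative_parametric_integral[OF smh open_ball sub x]] by metis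
    also have "\<dots> = integral {0..1} (\<lambda>t. t * (?D (z (t, x)) ?u \<bullet> P v) + \<omega> (z (t, x)) \<bullet> P v)"
      by (rule Henstock_Kurzweil_Integration.integral_cong) (rule dh)
    also have "\<dots> = \<omega> (z (1, x)) \<bullet> P v" using ftc by (simp add: integral_unique)
    finally show ?thesis by (simp add: z_def)
  qed
  ultimately show ?thesis by (rule that)
qed

subsection \<open>The Killing equation as a cubic form\<close>

lemma linear_expand_axis:
  fixes F :: "real^'n \<Rightarrow> 'b::real_vector"
  assumes "linear F"
  shows "F v = (\<Sum>k\<in>UNIV. v $ k *\<^sub>R F (axis k 1))"
proof -
  have "F v = F (\<Sum>k\<in>UNIV. v $ k *\<^sub>R axis k 1)"
    by (simp add: basis_expansion[of v, unfolded scalar_mult_eq_scaleR])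
  then show ?thesis by (simp only: linear_sum[OF assms] linear_scale[OF assms])
qed

lemma linear_eq_0_on_axes:
  fixes f :: "real^'n \<Rightarrow> real"
  assumes "linear f" "\<And>i. f (axis i 1) = 0"
  shows "f v = 0"
  by (subst linear_expand_axis[OF assms(1)]) (simp add: assms(2))

text \<open>\<open>DG\<close> and \<open>DT\<close> are the derivatives of the components of the metric \<open>g\<close> and of \<open>T = g K\<close> at a
  point. On \<open>v\<close> the form is the derivative along the geodesic with velocity \<open>v\<close> of the quadratic
  integral \<open>T(v, v)\<close>, with the Christoffel symbols eliminated.\<close>

definition killing_cubic ::
  "(real^'n \<Rightarrow> real^'n^'n) \<Rightarrow> (real^'n \<Rightarrow> real^'n^'n) \<Rightarrow> real^'n^'n \<Rightarrow> real^'n \<Rightarrow> real" where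
  "killing_cubic DG DT K v =
     v \<bullet> (DT v *v v) - 2 * (v \<bullet> (DG v *v (K *v v))) + v \<bullet> (DG (K *v v) *v v)"

lemma symmetric_matrix_inner:
  fixes A :: "real^'n^'n"
  assumes "transpose A = A"
  shows "a \<bullet> (A *v b) = b \<bullet> (A *v a)"
  using dot_lmul_matrix[of b A a] assms
  by (metis inner_commute vector_transpose_matrix)

lemma axis_inner_matrix_axis: "axis i 1 \<bullet> ((A::real^'n^'m) *v axis j 1) = A $ i $ j"
  by (simp add: matrix_vector_mult_basis inner_axis' column_def)

lemma matrix_sum_right: "(A::real^'n^'m) *v (\<Sum>i\<in>I. f i) = (\<Sum>i\<in>I. A *v f i)"
  by (rule linear_sum[OF matrix_vector_mul_linear])

lemma matrix_sum_left: "(\<Sum>i\<in>I. f i) *v (x::real^'n) = (\<Sum>i\<in>I. (f i :: real^'n^'m) *v x)"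
  by (induction I rule: infinite_finite_induct) (auto simp: matrix_vector_mult_add_rdistrib)

lemma matrix_inv_right: "invertible (A::real^'n^'m) \<Longrightarrow> A ** matrix_inv A = mat 1"
  unfolding invertible_def matrix_inv_def by (rule someI2_ex) auto

text \<open>Extended trilinearly from the coordinate vectors, the cyclic sum of covariant
  derivatives is a symmetric form \<open>S\<close> with \<open>S v v v\<close> equal to three times
  the cubic form. Polarisation recovers \<open>S\<close> from these values.\<close>

lemma killing_cubic_eq_0_iff:
  fixes G K T :: "real^'n^'n" and DG DT :: "real^'n \<Rightarrow> real^'n^'n"
  assumes "linear DG" "linear DT" and symG: "transpose G = G" and invG: "invertible G"
    and T: "T = G ** K" and symT: "transpose T = T" and symDT: "\<And>v. transpose (DT v) = DT v"
    and \<Gamma>: "\<And>s i j. \<Gamma> s i j = 1/2 * (\<Sum>l\<in>UNIV. matrix_inv G $ s $ l *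
       (DG (axis i 1) $ j $ l + DG (axis j 1) $ i $ l - DG (axis l 1) $ i $ j))"
    and cov: "\<And>i j k. cov i j k = DT (axis k 1) $ i $ j - (\<Sum>s\<in>UNIV. \<Gamma> s k i * T $ s $ j)
       - (\<Sum>s\<in>UNIV. \<Gamma> s k j * T $ i $ s)"
  shows "(\<forall>i j k. cov i j k + cov j k i + cov k i j = 0) \<longleftrightarrow> (\<forall>v. killing_cubic DG DT K v = 0)"
proof -
  interpret DG: linear DG by fact
  interpret DT: linear DT by fact
  \<comment> \<open>The Christoffel symbol of the first kind on \<open>x\<close>, \<open>y\<close>
    and \<open>K w\<close>, which is what the contraction of \<Gamma> with \<open>T\<close> amounts
    to. Accordingly \<open>c a b x\<close> is the covariant derivative of \<open>T\<close> along
    \<open>x\<close>, evaluated on \<open>a\<close> and \<open>b\<close>.\<close>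
  define L where "L x y w = 1/2 * (y \<bullet> (DG x *v (K *v w)) + x \<bullet> (DG y *v (K *v w)) - x \<bullet> (DG (K *v w) *v y))"
    for x y w
  define c where "c a b x = a \<bullet> (DT x *v b) - L x a b - L x b a" for a b x
  define S where "S a b x = c a b x + c b x a + c x a b" for a b x
  \<comment> \<open>This is where the inverse metric disappears. The sum runs over the row index of
    \<open>matrix_inv G\<close>, hence the detour through transposes and the symmetry of
    \<open>G\<close>.\<close>
  have GT: "(\<Sum>s\<in>UNIV. matrix_inv G $ s $ l * T $ s $ k) = K $ l $ k" for l k
  proof -
    have "T = transpose (transpose G ** K)" using T symG symT by simp
    then have "(\<Sum>s\<in>UNIV. matrix_inv G $ s $ l * T $ s $ k) = (transpose (matrix_inv G) ** (transpose G ** K)) $ l $ k"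
      using T symG by (simp add: matrix_matrix_mult_def transpose_def)
    also have "transpose (matrix_inv G) ** (transpose G ** K) = transpose (G ** matrix_inv G) ** K"
      by (simp add: matrix_transpose_mul matrix_mul_assoc)
    also have "\<dots> = K" by (simp add: matrix_inv_right[OF invG] transpose_mat)
    finally show ?thesis .
  qed
  have \<Gamma>T: "(\<Sum>s\<in>UNIV. \<Gamma> s i j * T $ s $ k) = L (axis i 1) (axis j 1) (axis k 1)" for i j k
  proof -
    let ?d = "\<lambda>l. DG (axis i 1) $ j $ l + DG (axis j 1) $ i $ l - DG (axis l 1) $ i $ j"
    have "(\<Sum>s\<in>UNIV. \<Gamma> s i j * T $ s $ k)
      = (\<Sum>s\<in>UNIV. \<Sum>l\<in>UNIV. 1/2 * (?d l * (matrix_inv G $ s $ l * T $ s $ k)))"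
      by (simp add: \<Gamma> sum_distrib_left sum_distrib_right mult_ac)
    also have "\<dots> = (\<Sum>l\<in>UNIV. 1/2 * (?d l * (\<Sum>s\<in>UNIV. matrix_inv G $ s $ l * T $ s $ k)))"
      by (subst sum.swap) (simp add: sum_distrib_left)
    also have "\<dots> = 1/2 * (\<Sum>l\<in>UNIV. K $ l $ k * ?d l)"
      unfolding GT by (simp add: sum_distrib_left mult_ac)
    also have "(\<Sum>l\<in>UNIV. K $ l $ k * ?d l) = (\<Sum>l\<in>UNIV. K $ l $ k *
       (axis j 1 \<bullet> (DG (axis i 1) *v axis l 1) + axis i 1 \<bullet> (DG (axis j 1) *v axis l 1)
        - axis i 1 \<bullet> (DG (axis l 1) *v axis j 1)))"
      by (simp add: axis_inner_matrix_axis)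
    also have "\<dots> = axis j 1 \<bullet> (DG (axis i 1) *v (\<Sum>l\<in>UNIV. K $ l $ k *\<^sub>R axis l 1))
        + axis i 1 \<bullet> (DG (axis j 1) *v (\<Sum>l\<in>UNIV. K $ l $ k *\<^sub>R axis l 1))
        - axis i 1 \<bullet> (DG (\<Sum>l\<in>UNIV. K $ l $ k *\<^sub>R axis l 1) *v axis j 1)"
      by (simp add: matrix_sum_right DG.sum DG.scale inner_sum_right matrix_sum_left matrix_vector_mult_scaleR
          scaleR_matrix_vector_assoc[symmetric] sum_subtractf sum.distrib algebra_simps)
    also have "(\<Sum>l\<in>UNIV. K $ l $ k *\<^sub>R axis l 1) = K *v axis k 1"
      using basis_expansion[of "K *v axis k 1"]
      by (simp add: scalar_mult_eq_scaleR matrix_vector_mult_basis column_def)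
    finally show ?thesis by (simp add: L_def)
  qed
  have covc: "cov i j k = c (axis i 1) (axis j 1) (axis k 1)" for i j k
  proof -
    have "T $ i $ s = T $ s $ i" for s by (metis symT transpose_def vec_lambda_beta)
    then show ?thesis by (simp add: cov \<Gamma>T c_def axis_inner_matrix_axis)
  qed
  have S_cyc: "S a b x = S b x a" for a b x by (simp add: S_def)
  have S_sym: "S a b x = S b a x" for a b x
    using symmetric_matrix_inner[OF symDT] by (simp add: S_def c_def)
  have S_diag: "S v v v = 3 * killing_cubic DG DT K v" for v
    by (simp add: S_def c_def L_def killing_cubic_def field_simps)
  note bilin = matrix_vector_right_distrib matrix_vector_mult_add_rdistrib inner_add_left inner_add_right
    DG.add DT.add DG.scale DT.scale scaleR_matrix_vector_assoc[symmetric] matrix_vector_mult_scaleR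
  have L_add: "L (a + b) y w = L a y w + L b y w" "L x (a + b) w = L x a w + L x b w"
    "L x y (a + b) = L x y a + L x y b" for a b x y w
    by (simp_all add: L_def bilin field_simps)
  have L_scale: "L (r *\<^sub>R a) y w = r * L a y w" "L x (r *\<^sub>R a) w = r * L x a w"
    "L x y (r *\<^sub>R a) = r * L x y a" for r a x y w
    by (simp_all add: L_def bilin field_simps)
  have S_lin: "linear (\<lambda>a. S a b x)" for b x
    by (rule linearI) (simp_all add: S_def c_def L_add L_scale bilin algebra_simps)
  have S_lin2: "linear (\<lambda>a. S b a x)" "linear (\<lambda>a. S x b a)" for b x
    using S_lin[of x b] by (simp_all only: S_cyc[of b _ x] S_cyc[of _ x b, symmetric])
  show ?thesis
  proof
    assume "\<forall>i j k. cov i j k + cov j k i + cov k i j = 0"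
    then have "S (axis i 1) (axis j 1) (axis k 1) = 0" for i j k by (simp add: S_def covc)
    then have "S a (axis j 1) (axis k 1) = 0" for a j k by (rule linear_eq_0_on_axes[OF S_lin])
    then have "S a b (axis k 1) = 0" for a b k by (rule linear_eq_0_on_axes[OF S_lin2(1)])
    then have "S a b x = 0" for a b x by (rule linear_eq_0_on_axes[OF S_lin2(2)])
    then show "\<forall>v. killing_cubic DG DT K v = 0" using S_diag by simp
  next
    assume "\<forall>v. killing_cubic DG DT K v = 0"
    then have S0: "S v v v = 0" for v using S_diag by simp
    note add = linear_add[OF S_lin] linear_add[OF S_lin2(1)] linear_add[OF S_lin2(2)]
    \<comment> \<open>Expanding the form on a + b and on a - b separates the terms that are odd and
      even in b. Applying the result to a + b in the repeated slots afterwards frees all three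
      arguments.\<close>
    have aab: "S a a b = 0" for a b
    proof -
      have neg: "S (-b) y x = - S b y x" "S y (-b) x = - S y b x" "S y x (-b) = - S y x b" for x y
        using linear_neg[OF S_lin] linear_neg[OF S_lin2(1)] linear_neg[OF S_lin2(2)] by blast+
      have perm: "S a b a = S a a b" "S b a a = S a a b" "S b a b = S a b b" "S b b a = S a b b"
        using S_cyc S_sym by metis+
      have "S (a + b) (a + b) (a + b) = 3 * S a a b + 3 * S a b b"
        by (simp add: add perm S0[of a] S0[of b])
      moreover have "S (a + - b) (a + - b) (a + - b) = - 3 * S a a b + 3 * S a b b"
        by (simp add: add neg perm S0[of a] S0[of b] del: add_uminus_conv_diff)
      ultimately show ?thesis using S0[of "a + b"] S0[of "a + - b"] by simp
    qed
    have "S a b x = 0" for a b x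
    proof -
      have "S (a + b) (a + b) x = S a b x + S b a x" by (simp only: add aab[of a] aab[of b])
      then show ?thesis using aab[of "a + b" x] S_sym[of b a x] by simp
    qed
    then show "\<forall>i j k. cov i j k + cov j k i + cov k i j = 0" by (simp add: covc flip: S_def)
  qed
qed

text \<open>Diagonal matrices contribute the square of \<open>v $ i\<close>, and expanding the
  direction of differentiation contributes \<open>v $ k\<close>. In the last term of the form that
  direction is \<open>K v\<close>, which accounts for the factor \<open>K $ k $ k\<close> there in
  place of \<open>K $ i $ i\<close>.\<close>

lemma killing_cubic_diagonal:
  fixes DG DT :: "real^'n \<Rightarrow> real^'n^'n"
  assumes "linear DG" "linear DT"
    and "\<And>v i j. i \<noteq> j \<Longrightarrow> DG v $ i $ j = 0" "\<And>v i j. i \<noteq> j \<Longrightarrow> DT v $ i $ j = 0"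
    and K: "\<And>i j. i \<noteq> j \<Longrightarrow> K $ i $ j = 0"
  shows "killing_cubic DG DT K v = (\<Sum>i\<in>UNIV. \<Sum>k\<in>UNIV. v $ k * (v $ i)\<^sup>2 *
     (DT (axis k 1) $ i $ i - 2 * DG (axis k 1) $ i $ i * K $ i $ i + DG (axis k 1) $ i $ i * K $ k $ k))"
proof -
  have diag: "(A *v w) $ i = A $ i $ i * w $ i" if "\<And>i j. i \<noteq> j \<Longrightarrow> A $ i $ j = 0"
    for A :: "real^'n^'n" and w i
  proof -
    have "(\<Sum>j\<in>UNIV. A $ i $ j * w $ j) = (\<Sum>j\<in>UNIV. if j = i then A $ i $ i * w $ i else 0)"
      by (rule sum.cong) (use that in auto)
    then show ?thesis by (simp add: matrix_vector_mult_def)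
  qed
  have expand: "F w $ i $ i = (\<Sum>k\<in>UNIV. w $ k * F (axis k 1) $ i $ i)"
    if "linear F" for F :: "real^'n \<Rightarrow> real^'n^'n" and w i
    by (subst linear_expand_axis[OF that]) simp
  have "killing_cubic DG DT K v = (\<Sum>i\<in>UNIV. v $ i * (DT v $ i $ i * v $ i)
      - 2 * (v $ i * (DG v $ i $ i * (K $ i $ i * v $ i))) + v $ i * (DG (K *v v) $ i $ i * v $ i))"
    using assms by (simp add: killing_cubic_def inner_vec_def diag sum.distrib sum_subtractf sum_distrib_left)
  also have "\<dots> = (\<Sum>i\<in>UNIV. (v $ i)\<^sup>2 * (DT v $ i $ i - 2 * DG v $ i $ i * K $ i $ i + DG (K *v v) $ i $ i))"
    by (simp add: power2_eq_square algebra_simps)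
  also have "\<dots> = (\<Sum>i\<in>UNIV. \<Sum>k\<in>UNIV. v $ k * (v $ i)\<^sup>2 *
     (DT (axis k 1) $ i $ i - 2 * DG (axis k 1) $ i $ i * K $ i $ i + DG (axis k 1) $ i $ i * K $ k $ k))"
  proof (rule sum.cong[OF refl])
    fix i
    have "DT v $ i $ i - 2 * DG v $ i $ i * K $ i $ i + DG (K *v v) $ i $ i =
      (\<Sum>k\<in>UNIV. v $ k * (DT (axis k 1) $ i $ i - 2 * DG (axis k 1) $ i $ i * K $ i $ i + DG (axis k 1) $ i $ i * K $ k $ k))"
      unfolding expand[OF assms(1), of v] expand[OF assms(2), of v] expand[OF assms(1), of "K *v v"]
      by (simp add: diag[OF K] sum_distrib_left sum_distrib_right sum.distrib sum_subtractf algebra_simps)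
    then show "(v $ i)\<^sup>2 * (DT v $ i $ i - 2 * DG v $ i $ i * K $ i $ i + DG (K *v v) $ i $ i) =
      (\<Sum>k\<in>UNIV. v $ k * (v $ i)\<^sup>2 *
       (DT (axis k 1) $ i $ i - 2 * DG (axis k 1) $ i $ i * K $ i $ i + DG (axis k 1) $ i $ i * K $ k $ k))"
      by (simp add: sum_distrib_left mult_ac)
  qed
  finally show ?thesis .
qed

text \<open>Different pairs (i, k) give different monomials v_k v_i^2, so the coefficients can be
  read off.\<close>

lemma diagonal_cubic_eq_0_iff:
  fixes B :: "'n::finite \<Rightarrow> 'n \<Rightarrow> real"
  shows "(\<forall>v::real^'n. (\<Sum>i\<in>UNIV. \<Sum>k\<in>UNIV. v $ k * (v $ i)\<^sup>2 * B i k) = 0) \<longleftrightarrow> (\<forall>i k. B i k = 0)"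
proof
  assume "\<forall>v::real^'n. (\<Sum>i\<in>UNIV. \<Sum>k\<in>UNIV. v $ k * (v $ i)\<^sup>2 * B i k) = 0"
  then have z: "(\<Sum>i\<in>UNIV. \<Sum>k\<in>UNIV. v $ k * (v $ i)\<^sup>2 * B i k) = 0" for v :: "real^'n" by blast
  have one: "B i i = 0" for i
  proof -
    have "(\<Sum>j\<in>UNIV. \<Sum>k\<in>UNIV. axis i 1 $ k * (axis i 1 $ j)\<^sup>2 * B j k)
      = (\<Sum>j\<in>UNIV. \<Sum>k\<in>UNIV. if k = i then (if j = i then B i i else 0) else 0)"
      by (intro sum.cong refl) (auto simp: axis_def)
    then show ?thesis using z[of "axis i 1"] by simp
  qed
  \<comment> \<open>Evaluation at s times the i-th basis vector plus the k-th one; the pure cubes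
    are already gone, and s = 1 and s = -1 separate the two remaining coefficients.\<close>
  have two: "s * B k i + s\<^sup>2 * B i k = 0" if "i \<noteq> k" for i k s
  proof -
    define v :: "real^'n" where "v = (\<chi> j. if j = i then s else if j = k then 1 else 0)"
    have in_sum: "(\<Sum>m\<in>UNIV. v $ m * (v $ j)\<^sup>2 * B j m) = (v $ j)\<^sup>2 * (s * B j i + B j k)" for j
    proof -
      have "(\<Sum>m\<in>UNIV. v $ m * (v $ j)\<^sup>2 * B j m)
        = (\<Sum>m\<in>UNIV. (if m = i then s * (v $ j)\<^sup>2 * B j i else 0) + (if m = k then (v $ j)\<^sup>2 * B j k else 0))"
        by (intro sum.cong refl) (use that in \<open>auto simp: v_def\<close>)
      then show ?thesis by (simp add: sum.distrib algebra_simps)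
    qed
    have "(\<Sum>j\<in>UNIV. \<Sum>m\<in>UNIV. v $ m * (v $ j)\<^sup>2 * B j m)
      = (\<Sum>j\<in>UNIV. (if j = i then s\<^sup>2 * (s * B i i + B i k) else 0) + (if j = k then s * B k i + B k k else 0))"
      unfolding in_sum by (intro sum.cong refl) (use that in \<open>auto simp: v_def\<close>)
    then show ?thesis using z[of v] by (simp add: sum.distrib one)
  qed
  show "\<forall>i k. B i k = 0"
  proof (intro allI)
    fix i k show "B i k = 0"
      using one two[of i k 1] two[of i k "-1"] by (cases "i = k") auto
  qed
qed simp

subsection \<open>Charts and tensor fields\<close>

lemma frechet_derivative_vec_nth:
  assumes "f differentiable (at x)"
  shows "frechet_derivative (\<lambda>y. f y $ i) (at x) v = frechet_derivative f (at x) v $ i"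
  using frechet_derivative_at[OF bounded_linear.has_derivative[OF bounded_linear_vec_nth
      assms[unfolded frechet_derivative_works], of i]] by metis

lemma bounded_bilinear_matrix_vector: "bounded_bilinear ((*v) :: real^'n^'m \<Rightarrow> _)"
  unfolding bilinear_conv_bounded_bilinear[symmetric] bilinear_def
  by (auto intro!: linearI simp: matrix_vector_right_distrib matrix_vector_mult_add_rdistrib
      matrix_vector_mult_scaleR scaleR_matrix_vector_assoc[symmetric])

lemma lower_index_matrix: "lower_index g K c p = transpose (g c p) ** K c p"
  by (simp add: lower_index_def matrix_matrix_mult_def transpose_def)

locale smooth_manifold =
  fixes \<A> :: "('m::topological_space, 'n::finite) chart set"
  assumes atlas: "smooth_structure \<A>"
begin

lemma chart: "c \<in> \<A> \<Longrightarrow> is_chart c"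
  using atlas by (simp add: smooth_structure_def)

lemma chart_homeomorphism: "c \<in> \<A> \<Longrightarrow> homeomorphism (fst c) (snd c ` fst c) (snd c) (inv_chart c)"
  using chart by (simp add: is_chart_def)

lemma inv_chart_left: "c \<in> \<A> \<Longrightarrow> p \<in> fst c \<Longrightarrow> inv_chart c (snd c p) = p"
  using chart_homeomorphism homeomorphism_apply1 by blast

lemma open_chart_image:
  assumes "c \<in> \<A>" "open W" shows "open (snd c ` (fst c \<inter> W))"
proof -
  have "openin (top_of_set (snd c ` fst c)) (snd c ` (fst c \<inter> W))"
    by (rule homeomorphism_imp_open_map[OF chart_homeomorphism[OF assms(1)]])
      (use assms(2) in \<open>simp add: openin_open_Int\<close>)
  then show ?thesis
    using openin_open_trans chart[OF assms(1)] by (auto simp: is_chart_def)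
qed

lemma open_chart: "c \<in> \<A> \<Longrightarrow> open (fst c)"
  using chart by (simp add: is_chart_def)

lemma smooth_transition:
  assumes "c \<in> \<A>" "d \<in> \<A>"
  shows "smooth_on (snd d \<circ> inv_chart c) (snd c ` (fst c \<inter> fst d))"
  using atlas assms by (simp add: smooth_structure_def compatible_def)

lemma open_overlap: "c \<in> \<A> \<Longrightarrow> d \<in> \<A> \<Longrightarrow> open (snd c ` (fst c \<inter> fst d))"
  by (simp add: open_chart_image open_chart)

lemma transition_differentiable:
  assumes "c \<in> \<A>" "d \<in> \<A>" "p \<in> fst c" "p \<in> fst d"
  shows "(snd d \<circ> inv_chart c) differentiable (at (snd c p))"
  using smooth_on_differentiable[OF smooth_transition[OF assms(1,2)]] assms by blast

lemma jacobian_mult_vec: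
  assumes "c \<in> \<A>" "d \<in> \<A>" "p \<in> fst c" "p \<in> fst d"
  shows "jacobian c d p *v v = frechet_derivative (snd d \<circ> inv_chart c) (at (snd c p)) v"
proof -
  let ?F = "frechet_derivative (snd d \<circ> inv_chart c) (at (snd c p))"
  have lin: "linear ?F"
    by (rule linear_frechet_derivative[OF transition_differentiable[OF assms]])
  have "jacobian c d p = matrix ?F"
    using frechet_derivative_vec_nth[OF transition_differentiable[OF assms]]
    by (simp add: jacobian_def matrix_def pderiv_chart_def o_def)
  then show ?thesis using matrix_vector_mul(2)[OF lin] by metis
qed

text \<open>The chain rule for the transition map. The composite through the other chart equals
  \<open>f \<circ> inv_chart d\<close> only on the image of the overlap, which is open and therefore
  sufficient for the derivative.\<close>

lemma has_derivative_change_chart: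
  assumes "c \<in> \<A>" "d \<in> \<A>" "p \<in> fst c" "p \<in> fst d"
    and f: "((f \<circ> inv_chart c) has_derivative f') (at (snd c p))"
  shows "((f \<circ> inv_chart d) has_derivative (\<lambda>v. f' (jacobian d c p *v v))) (at (snd d p))"
proof -
  have 1: "((snd c \<circ> inv_chart d) has_derivative (\<lambda>v. jacobian d c p *v v)) (at (snd d p))"
    using transition_differentiable[OF assms(2,1,4,3)]
    by (simp add: jacobian_mult_vec[OF assms(2,1,4,3)] frechet_derivative_works)
  have "(snd c \<circ> inv_chart d) (snd d p) = snd c p" using assms by (simp add: inv_chart_left)
  then have "((\<lambda>x. (f \<circ> inv_chart c) ((snd c \<circ> inv_chart d) x)) has_derivative
      (\<lambda>v. f' (jacobian d c p *v v))) (at (snd d p))"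
    using has_derivative_compose[OF 1, of "f \<circ> inv_chart c" f'] f by simp
  then show ?thesis
  proof (rule has_derivative_transform_within_open[OF _ open_overlap[OF assms(2,1)]])
    show "snd d p \<in> snd d ` (fst d \<inter> fst c)" using assms by blast
    show "(f \<circ> inv_chart c) ((snd c \<circ> inv_chart d) x) = (f \<circ> inv_chart d) x"
      if "x \<in> snd d ` (fst d \<inter> fst c)" for x
      using that assms by (auto simp: inv_chart_left)
  qed
qed

lemma frechet_derivative_change_chart:
  assumes "c \<in> \<A>" "d \<in> \<A>" "p \<in> fst c" "p \<in> fst d"
    and f: "(f \<circ> inv_chart c) differentiable (at (snd c p))"
  shows "frechet_derivative (f \<circ> inv_chart d) (at (snd d p)) v
    = frechet_derivative (f \<circ> inv_chart c) (at (snd c p)) (jacobian d c p *v v)"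
  using frechet_derivative_at[OF has_derivative_change_chart[OF assms(1-4)
        f[unfolded frechet_derivative_works]]] by metis

lemma jacobian_chain:
  assumes "c \<in> \<A>" "d \<in> \<A>" "e \<in> \<A>" "p \<in> fst c" "p \<in> fst d" "p \<in> fst e"
  shows "jacobian d e p ** jacobian c d p = jacobian c e p"
  unfolding matrix_eq
  using frechet_derivative_change_chart[OF assms(2,1,5,4)
      transition_differentiable[OF assms(2,3,5,6)]]
  by (simp add: assms jacobian_mult_vec flip: matrix_vector_mul_assoc)

lemma jacobian_refl:
  assumes "c \<in> \<A>" "p \<in> fst c"
  shows "jacobian c c p = mat 1"
proof -
  have "((snd c \<circ> inv_chart c) has_derivative (\<lambda>v. v)) (at (snd c p))"
    by (rule has_derivative_transform_within_open[OF has_derivative_ident open_overlap[OF assms(1,1)]])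
      (use assms in \<open>auto simp: inv_chart_left\<close>)
  from frechet_derivative_at[OF this, symmetric] show ?thesis
    unfolding matrix_eq by (simp add: jacobian_mult_vec assms)
qed

lemma jacobian_inverse:
  assumes "c \<in> \<A>" "d \<in> \<A>" "p \<in> fst c" "p \<in> fst d"
  shows "jacobian c d p ** jacobian d c p = mat 1"
  using jacobian_chain[of d c d p] jacobian_refl assms by simp

text \<open>Maximality of the atlas supplies the restricted chart. Its \<open>inv_chart\<close>
  inverts on a smaller domain, so as a total function it may differ from that of \<open>c\<close>;
  both agree on the smaller image, where compatibility is checked. Such charts provide diagonalising
  coordinates contained in a given neighbourhood.\<close>

lemma restrict_chart:
  assumes c: "c \<in> \<A>" and "open W"
  shows "(fst c \<inter> W, snd c) \<in> \<A>"
proof -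
  let ?c = "(fst c \<inter> W, snd c)"
  have inj: "inj_on (snd c) (fst c)" using inv_chart_left[OF c] by (metis inj_onI)
  have inv: "inv_chart ?c (snd c q) = q" if "q \<in> fst c" "q \<in> W" for q
    unfolding inv_chart_def fst_conv snd_conv
    by (rule inv_into_f_f) (use that inj in \<open>auto simp: inj_on_def\<close>)
  have hom: "homeomorphism (fst c \<inter> W) (snd c ` (fst c \<inter> W)) (snd c) (inv_chart c)"
    by (rule homeomorphism_of_subsets[OF chart_homeomorphism[OF c]]) auto
  have "homeomorphism (fst c \<inter> W) (snd c ` (fst c \<inter> W)) (snd c) (inv_chart ?c)"
    by (rule homeomorphism_cong[OF hom]) (use inv c in \<open>auto simp: inv_chart_left\<close>)
  then have "is_chart ?c"
    using assms by (simp add: is_chart_def open_chart_image open_chart open_Int)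
  moreover have "compatible ?c d" if d: "d \<in> \<A>" for d
    unfolding compatible_def fst_conv snd_conv
  proof
    have o: "open (snd c ` (fst c \<inter> W \<inter> fst d))"
      using open_chart_image[OF c, of "W \<inter> fst d"] assms d by (simp add: open_chart Int_assoc open_Int)
    have "smooth_on (snd d \<circ> inv_chart c) (snd c ` (fst c \<inter> W \<inter> fst d))"
      by (rule smooth_on_subset[OF smooth_transition[OF c d]]) auto
    then show "smooth_on (snd d \<circ> inv_chart ?c) (snd c ` (fst c \<inter> W \<inter> fst d))"
      by (subst smooth_on_cong[OF o, of _ "snd d \<circ> inv_chart c"])
        (use c in \<open>auto simp: inv inv_chart_left\<close>)
    show "smooth_on (snd c \<circ> inv_chart d) (snd d ` (fst c \<inter> W \<inter> fst d))"
      by (rule smooth_on_subset[OF smooth_transition[OF d c]]) auto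
  qed
  ultimately show ?thesis using atlas unfolding smooth_structure_def by blast
qed

text \<open>Tensor fields are families indexed by charts, so their components in a restricted chart
  are tied to the original ones only through the transformation law; this shows that the law is then
  trivial.\<close>

lemma jacobian_restrict_chart:
  assumes c: "c \<in> \<A>" and "open W" and "p \<in> fst c \<inter> W"
  shows "jacobian c (fst c \<inter> W, snd c) p = mat 1" "jacobian (fst c \<inter> W, snd c) c p = mat 1"
proof -
  have *: "jacobian c (fst c \<inter> W, snd c) p = jacobian c c p" by (simp add: jacobian_def)
  then show "jacobian c (fst c \<inter> W, snd c) p = mat 1" using assms jacobian_refl by simp
  then show "jacobian (fst c \<inter> W, snd c) c p = mat 1"
    using jacobian_inverse[OF restrict_chart[OF c \<open>open W\<close>] c, of p] assms by simp
qed

section \<open>Invariance of the Killing equation under changes of chart\<close>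

lemma tensor02_law:
  assumes "tensor02_on \<A> W h" "c \<in> \<A>" "d \<in> \<A>" "p \<in> fst c" "p \<in> fst d" "p \<in> W"
  shows "v \<bullet> (h d p *v w) = (jacobian d c p *v v) \<bullet> (h c p *v (jacobian d c p *v w))"
proof -
  have "h d p = transpose (jacobian d c p) ** h c p ** jacobian d c p"
    using assms unfolding tensor02_on_def by blast
  moreover have "v \<bullet> (transpose A *v u) = (A *v v) \<bullet> u" for A :: "real^'n^'n" and u
    by (metis dot_lmul_matrix vector_transpose_matrix)
  ultimately show ?thesis by (simp flip: matrix_vector_mul_assoc)
qed

text \<open>Differentiate the identity h_d(v, w) = h_c(J v, J w) along \<open>u\<close>, where the
  Jacobian J varies too. The non-tensorial terms with \<open>D2\<close> are kept explicit because
  they are to cancel in the cubic form.\<close>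

lemma tensor02_frechet_derivative:
  fixes c d :: "('m, 'n) chart" and h
  assumes h: "tensor02_on \<A> W h" and W: "open W" and cd: "c \<in> \<A>" "d \<in> \<A>"
    and p: "p \<in> fst c" "p \<in> fst d" "p \<in> W"
  defines "D2 \<equiv> \<lambda>u v. frechet_derivative (\<lambda>y. frechet_derivative (snd c \<circ> inv_chart d) (at y) v) (at (snd d p)) u"
  shows "v \<bullet> (frechet_derivative (h d \<circ> inv_chart d) (at (snd d p)) u *v w)
    = D2 u v \<bullet> (h c p *v (jacobian d c p *v w))
      + (jacobian d c p *v v) \<bullet>
        (frechet_derivative (h c \<circ> inv_chart c) (at (snd c p)) (jacobian d c p *v u) *v (jacobian d c p *v w))
      + (jacobian d c p *v v) \<bullet> (h c p *v D2 u w)"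
proof -
  let ?\<phi> = "snd c \<circ> inv_chart d"
  let ?x = "snd d p"
  let ?J = "\<lambda>v y. frechet_derivative ?\<phi> (at y) v"
  have smh: "smooth_on (h e \<circ> inv_chart e) (snd e ` (fst e \<inter> W))" if "e \<in> \<A>" for e
    using h that by (simp add: tensor02_on_def smooth_components_def)
  have dJ: "(?J v has_derivative (\<lambda>u. D2 u v)) (at ?x)" for v
    unfolding D2_def
    by (rule smooth_on_has_derivative[OF smooth_on_frechet_derivative[OF smooth_transition[OF cd(2,1)]]])
      (use p in auto)
  have dH: "((h c \<circ> inv_chart c \<circ> ?\<phi>) has_derivative
      (\<lambda>u. frechet_derivative (h c \<circ> inv_chart c) (at (snd c p)) (jacobian d c p *v u))) (at ?x)"
  proof (rule has_derivative_transform_within_open[OF _ open_overlap[OF cd(2,1)]])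
    show "((h c \<circ> inv_chart d) has_derivative
        (\<lambda>u. frechet_derivative (h c \<circ> inv_chart c) (at (snd c p)) (jacobian d c p *v u))) (at ?x)"
      by (rule has_derivative_change_chart[OF cd p(1,2) smooth_on_has_derivative[OF smh[OF cd(1)]]])
        (use p in auto)
  qed (use p cd in \<open>auto simp: inv_chart_left\<close>)
  have hx: "(h c \<circ> inv_chart c \<circ> ?\<phi>) ?x = h c p" using cd p by (simp add: inv_chart_left)
  have Jx: "?J v ?x = jacobian d c p *v v" for v
    by (rule jacobian_mult_vec[OF cd(2,1) p(2,1), symmetric])
  let ?N = "snd d ` (fst d \<inter> (fst c \<inter> W))"
  have oN: "open ?N" by (intro open_chart_image cd open_Int open_chart W)
  have "((\<lambda>y. ?J v y \<bullet> ((h c \<circ> inv_chart c \<circ> ?\<phi>) y *v ?J w y)) has_derivative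
     (\<lambda>u. ?J v ?x \<bullet> ((h c \<circ> inv_chart c \<circ> ?\<phi>) ?x *v D2 u w
          + frechet_derivative (h c \<circ> inv_chart c) (at (snd c p)) (jacobian d c p *v u) *v ?J w ?x)
        + D2 u v \<bullet> ((h c \<circ> inv_chart c \<circ> ?\<phi>) ?x *v ?J w ?x))) (at ?x)"
    by (rule has_derivative_inner[OF dJ bounded_bilinear.FDERIV[OF bounded_bilinear_matrix_vector dH dJ]])
  then have R: "((\<lambda>y. v \<bullet> ((h d \<circ> inv_chart d) y *v w)) has_derivative
     (\<lambda>u. ?J v ?x \<bullet> ((h c \<circ> inv_chart c \<circ> ?\<phi>) ?x *v D2 u w
          + frechet_derivative (h c \<circ> inv_chart c) (at (snd c p)) (jacobian d c p *v u) *v ?J w ?x)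
        + D2 u v \<bullet> ((h c \<circ> inv_chart c \<circ> ?\<phi>) ?x *v ?J w ?x))) (at ?x)"
  proof (rule has_derivative_transform_within_open[OF _ oN])
    show "?x \<in> ?N" using p by blast
    fix y assume "y \<in> ?N"
    then obtain q where q: "y = snd d q" "q \<in> fst d" "q \<in> fst c" "q \<in> W" by blast
    have "?J v y = jacobian d c q *v v" for v
      using jacobian_mult_vec[OF cd(2,1) q(2,3)] q(1) by simp
    then show "?J v y \<bullet> ((h c \<circ> inv_chart c \<circ> ?\<phi>) y *v ?J w y) = v \<bullet> ((h d \<circ> inv_chart d) y *v w)"
      using tensor02_law[OF h cd q(3,2,4), of v w] q cd by (simp add: inv_chart_left)
  qed
  have "((h d \<circ> inv_chart d) has_derivative frechet_derivative (h d \<circ> inv_chart d) (at ?x)) (at ?x)"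
    by (rule smooth_on_has_derivative[OF smh[OF cd(2)]]) (use p in auto)
  then have L: "((\<lambda>y. v \<bullet> ((h d \<circ> inv_chart d) y *v w)) has_derivative
      (\<lambda>u. v \<bullet> (frechet_derivative (h d \<circ> inv_chart d) (at ?x) u *v w))) (at ?x)"
    by (intro has_derivative_inner_right
        bounded_linear.has_derivative[OF bounded_bilinear.bounded_linear_left[OF bounded_bilinear_matrix_vector]])
  show ?thesis
    using fun_cong[OF has_derivative_unique[OF L R], of u]
    unfolding Jx hx by (simp add: inner_add_right)
qed

lemma smooth_components_entry:
  assumes "smooth_components \<A> W (T :: ('m, 'n) chart \<Rightarrow> 'm \<Rightarrow> real^'n^'n)" "open W" "c \<in> \<A>"
  shows "smooth_on (\<lambda>x. T c (inv_chart c x) $ i $ j) (snd c ` (fst c \<inter> W))"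
  using assms unfolding smooth_components_def o_def
  by (intro smooth_on_vec_nth open_chart_image) auto

lemma frechet_derivative_entry:
  assumes T: "smooth_components \<A> W (T :: ('m, 'n) chart \<Rightarrow> 'm \<Rightarrow> real^'n^'n)"
    and c: "c \<in> \<A>" and p: "p \<in> fst c" "p \<in> W"
  shows "frechet_derivative (T c \<circ> inv_chart c) (at (snd c p)) v $ i $ j
    = frechet_derivative ((\<lambda>q. T c q $ i $ j) \<circ> inv_chart c) (at (snd c p)) v"
proof -
  have 1: "(T c \<circ> inv_chart c) differentiable (at (snd c p))"
    by (rule smooth_on_differentiable[where S = "snd c ` (fst c \<inter> W)"])
      (use T c p in \<open>auto simp: smooth_components_def\<close>)
  then have 2: "(\<lambda>y. (T c \<circ> inv_chart c) y $ i) differentiable (at (snd c p))"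
    using bounded_linear.has_derivative[OF bounded_linear_vec_nth] unfolding differentiable_def by blast
  show ?thesis
    using frechet_derivative_vec_nth[OF 2, of j] frechet_derivative_vec_nth[OF 1, of i] by (simp add: o_def)
qed

text \<open>In the product the Jacobian coming from the contracted index of \<open>g\<close> meets
  the inverse Jacobian coming from the upper index of \<open>K\<close>, and they cancel.\<close>

lemma tensor02_lower_index:
  assumes g: "tensor02_on \<A> W g" and K: "tensor11_on \<A> UNIV K" and "open W"
  shows "tensor02_on \<A> W (lower_index g K)"
  unfolding tensor02_on_def
proof (intro conjI ballI)
  have sg: "smooth_components \<A> W g" using g by (simp add: tensor02_on_def)
  have sK: "smooth_components \<A> W K"
    using K unfolding tensor11_on_def smooth_components_def by (auto intro: smooth_on_subset)
  show "smooth_components \<A> W (lower_index g K)"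
    unfolding smooth_components_def
  proof
    fix c assume c: "c \<in> \<A>"
    note o = open_chart_image[OF c \<open>open W\<close>]
    show "smooth_on (lower_index g K c \<circ> inv_chart c) (snd c ` (fst c \<inter> W))"
      unfolding lower_index_def o_def
      by (intro smooth_on_vec_lambda smooth_on_sum smooth_on_mult o
          smooth_components_entry[OF sg \<open>open W\<close> c] smooth_components_entry[OF sK \<open>open W\<close> c])
  qed
  fix c d p assume cd: "c \<in> \<A>" "d \<in> \<A>" and p: "p \<in> fst c \<inter> fst d \<inter> W"
  have Kd: "K d p = jacobian c d p ** K c p ** jacobian d c p"
    using K cd p unfolding tensor11_on_def by blast
  have gd: "g d p = transpose (jacobian d c p) ** g c p ** jacobian d c p"
    using g cd p unfolding tensor02_on_def by blast
  have inv: "jacobian d c p ** jacobian c d p = mat 1"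
    using jacobian_inverse[OF cd(2,1)] p by simp
  have "lower_index g K d p = transpose (jacobian d c p) ** transpose (g c p)
      ** (jacobian d c p ** jacobian c d p) ** K c p ** jacobian d c p"
    by (simp add: lower_index_matrix Kd gd matrix_transpose_mul transpose_transpose matrix_mul_assoc)
  then show "lower_index g K d p = transpose (jacobian d c p) ** lower_index g K c p ** jacobian d c p"
    by (simp add: inv lower_index_matrix matrix_mul_assoc)
qed

definition killing_form ::
  "(('m, 'n) chart \<Rightarrow> 'm \<Rightarrow> real^'n^'n) \<Rightarrow> (('m, 'n) chart \<Rightarrow> 'm \<Rightarrow> real^'n^'n) \<Rightarrow> ('m, 'n) chart \<Rightarrow>
   'm \<Rightarrow> real^'n \<Rightarrow> real" where
  "killing_form g K c p = killing_cubic
     (frechet_derivative (g c \<circ> inv_chart c) (at (snd c p)))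
     (frechet_derivative (lower_index g K c \<circ> inv_chart c) (at (snd c p))) (K c p)"

text \<open>The second derivatives of the coordinate change cancel: \<open>T\<close> against \<open>g K\<close> in the first two terms of the
  form, and by their symmetry in the last two.\<close>

lemma killing_form_change_chart:
  assumes g: "metric_on \<A> W g" and K: "tensor11_on \<A> UNIV K" and W: "open W"
    and cd: "c \<in> \<A>" "d \<in> \<A>" and p: "p \<in> fst c" "p \<in> fst d" "p \<in> W"
    and sym: "transpose (lower_index g K c p) = lower_index g K c p"
  shows "killing_form g K d p v = killing_form g K c p (jacobian d c p *v v)"
proof -
  let ?J = "jacobian d c p"
  let ?\<phi> = "snd c \<circ> inv_chart d"
  define D2 where "D2 u v = frechet_derivative (\<lambda>y. frechet_derivative ?\<phi> (at y) v) (at (snd d p)) u" for u v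
  have g2: "tensor02_on \<A> W g" using g by (simp add: metric_on_def)
  have symg: "transpose (g c p) = g c p" using g cd p by (simp add: metric_on_def)
  have D2sym: "D2 u v = D2 v u" for u v
    unfolding D2_def
    by (rule second_derivative_symmetric[OF smooth_transition[OF cd(2,1)] open_overlap[OF cd(2,1)]])
      (use p in auto)
  have "K d p = jacobian c d p ** K c p ** jacobian d c p"
    using K cd p unfolding tensor11_on_def by blast
  then have "?J ** K d p = (?J ** jacobian c d p) ** K c p ** ?J"
    by (simp add: matrix_mul_assoc)
  then have "?J ** K d p = K c p ** ?J" using jacobian_inverse[OF cd(2,1) p(2,1)] by simp
  \<comment> \<open>The vector \<open>K v\<close> transforms like \<open>v\<close>, so each
    occurrence of it in the form in chart \<open>d\<close> passes to its counterpart in chart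
    \<open>c\<close>.\<close>
  then have JK: "?J *v (K d p *v v) = K c p *v (?J *v v)" by (metis matrix_vector_mul_assoc)
  have T: "lower_index g K c p *v w = g c p *v (K c p *v w)" for w
    by (simp add: lower_index_matrix symg flip: matrix_vector_mul_assoc)
  note Dg = tensor02_frechet_derivative[OF g2 W cd p, folded D2_def]
  note DT = tensor02_frechet_derivative[OF tensor02_lower_index[OF g2 K W] W cd p, folded D2_def]
  show ?thesis
    unfolding killing_form_def killing_cubic_def Dg DT JK D2sym[of "K d p *v v"]
    using symmetric_matrix_inner[OF sym, of "D2 v v" "?J *v v"]
      symmetric_matrix_inner[OF symg, of "?J *v v" "D2 v (K d p *v v)"]
    by (simp add: T)
qed

text \<open>Symmetry of \<open>T\<close> is required at all points of the chart in \<open>W\<close>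
  and not only at \<open>p\<close>, since polarisation also uses the symmetry of the derivative of
  \<open>T\<close>, obtained by differentiating the identity of \<open>T\<close> with its
  transpose.\<close>

lemma killing_equation_iff:
  assumes g: "metric_on \<A> W g" and K: "tensor11_on \<A> UNIV K" and W: "open W"
    and c: "c \<in> \<A>" and p: "p \<in> fst c" "p \<in> W"
    and sym: "\<And>q. q \<in> fst c \<Longrightarrow> q \<in> W \<Longrightarrow> transpose (lower_index g K c q) = lower_index g K c q"
  shows "(\<forall>i j k. cov_deriv g (lower_index g K) c i j k p + cov_deriv g (lower_index g K) c j k i p
      + cov_deriv g (lower_index g K) c k i j p = 0) \<longleftrightarrow> (\<forall>v. killing_form g K c p v = 0)"
  unfolding killing_form_def
proof (rule killing_cubic_eq_0_iff)
  let ?x = "snd c p"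
  let ?T = "lower_index g K"
  have g2: "tensor02_on \<A> W g" using g by (simp add: metric_on_def)
  have diff: "(h c \<circ> inv_chart c) differentiable (at ?x)" if "tensor02_on \<A> W h" for h
    by (rule smooth_on_differentiable[where S = "snd c ` (fst c \<inter> W)"])
      (use that c p in \<open>auto simp: tensor02_on_def smooth_components_def\<close>)
  note T2 = tensor02_lower_index[OF g2 K W]
  have entry: "pderiv_chart c k (\<lambda>q. h c q $ i $ j) p
      = frechet_derivative (h c \<circ> inv_chart c) (at ?x) (axis k 1) $ i $ j" if "tensor02_on \<A> W h" for h i j k
    using frechet_derivative_entry[OF _ c p, of h] that by (simp add: tensor02_on_def pderiv_chart_def)
  show "linear (frechet_derivative (g c \<circ> inv_chart c) (at ?x))"
    "linear (frechet_derivative (?T c \<circ> inv_chart c) (at ?x))"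
    by (intro linear_frechet_derivative diff g2 T2)+
  show symg: "transpose (g c p) = g c p" and "invertible (g c p)"
    using g c p by (auto simp: metric_on_def)
  show "?T c p = g c p ** K c p" by (simp add: lower_index_matrix symg)
  show "transpose (?T c p) = ?T c p" by (rule sym[OF p])
  show "transpose (frechet_derivative (?T c \<circ> inv_chart c) (at ?x) v)
      = frechet_derivative (?T c \<circ> inv_chart c) (at ?x) v" for v
  proof -
    have lt: "bounded_linear (transpose :: real^'n^'n \<Rightarrow> _)"
      unfolding linear_conv_bounded_linear[symmetric]
      by (rule linearI) (simp_all add: transpose_def vec_eq_iff)
    have d: "((?T c \<circ> inv_chart c) has_derivative frechet_derivative (?T c \<circ> inv_chart c) (at ?x)) (at ?x)"
      using diff[OF T2] by (simp add: frechet_derivative_works)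
    have "((\<lambda>y. transpose ((?T c \<circ> inv_chart c) y)) has_derivative
        (\<lambda>v. transpose (frechet_derivative (?T c \<circ> inv_chart c) (at ?x) v))) (at ?x)"
      by (rule bounded_linear.has_derivative[OF lt d])
    then have "((?T c \<circ> inv_chart c) has_derivative
        (\<lambda>v. transpose (frechet_derivative (?T c \<circ> inv_chart c) (at ?x) v))) (at ?x)"
      by (rule has_derivative_transform_within_open[OF _ open_chart_image[OF c W]])
        (use p c sym in \<open>auto simp: inv_chart_left\<close>)
    from fun_cong[OF has_derivative_unique[OF this d]] show ?thesis .
  qed
  show "christoffel g c s i j p = 1/2 * (\<Sum>l\<in>UNIV. matrix_inv (g c p) $ s $ l *
      (frechet_derivative (g c \<circ> inv_chart c) (at ?x) (axis i 1) $ j $ l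
       + frechet_derivative (g c \<circ> inv_chart c) (at ?x) (axis j 1) $ i $ l
       - frechet_derivative (g c \<circ> inv_chart c) (at ?x) (axis l 1) $ i $ j))" for s i j
    by (simp add: christoffel_def entry[OF g2])
  show "cov_deriv g ?T c i j k p = frechet_derivative (?T c \<circ> inv_chart c) (at ?x) (axis k 1) $ i $ j
      - (\<Sum>s\<in>UNIV. christoffel g c s k i p * ?T c p $ s $ j)
      - (\<Sum>s\<in>UNIV. christoffel g c s k j p * ?T c p $ i $ s)" for i j k
    by (simp add: cov_deriv_def entry[OF T2])
qed

end

subsection \<open>Diagonalising coordinates\<close>

lemma cmatrix_mult: "cmatrix (A ** B) = cmatrix A ** cmatrix B"
  by (simp add: cmatrix_def matrix_matrix_mult_def vec_eq_iff)

lemma cmatrix_mat_1: "cmatrix (mat 1) = mat 1"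
  by (simp add: cmatrix_def mat_def vec_eq_iff)

lemma cmatrix_diagonal_mult_vec:
  assumes "\<And>i j. i \<noteq> j \<Longrightarrow> B $ i $ j = 0"
  shows "(cmatrix B *v v) $ i = complex_of_real (B $ i $ i) * v $ i"
proof -
  have "(\<Sum>j\<in>UNIV. complex_of_real (B $ i $ j) * v $ j)
      = (\<Sum>j\<in>UNIV. if j = i then complex_of_real (B $ i $ i) * v $ i else 0)"
    by (rule sum.cong) (use assms in auto)
  then show ?thesis by (simp add: cmatrix_def matrix_vector_mult_def)
qed

lemma eigenvalues_diagonal:
  assumes "\<And>i j. i \<noteq> j \<Longrightarrow> B $ i $ j = 0"
  shows "eigenvalues B = range (\<lambda>i. complex_of_real (B $ i $ i))"
proof (intro set_eqI iffI)
  fix l assume "l \<in> eigenvalues B"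
  then obtain v where "v \<noteq> 0" and v: "cmatrix B *v v = l *s v" by (auto simp: eigenvalues_def)
  from \<open>v \<noteq> 0\<close> obtain i where "v $ i \<noteq> 0" by (auto simp: vec_eq_iff)
  moreover have "complex_of_real (B $ i $ i) * v $ i = l * v $ i"
    using v cmatrix_diagonal_mult_vec[OF assms, where v = v and i = i] by (metis vector_smult_component)
  ultimately show "l \<in> range (\<lambda>i. complex_of_real (B $ i $ i))" by auto
next
  fix l assume "l \<in> range (\<lambda>i. complex_of_real (B $ i $ i))"
  then obtain i where "l = complex_of_real (B $ i $ i)" by blast
  then have "cmatrix B *v axis i 1 = l *s axis i 1"
    using cmatrix_diagonal_mult_vec[OF assms, where v = "axis i 1"] by (simp add: vec_eq_iff axis_def)
  moreover have "axis i (1::complex) \<noteq> 0" by (simp add: axis_eq_0_iff)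
  ultimately show "l \<in> eigenvalues B" unfolding eigenvalues_def by blast
qed

text \<open>The n diagonal entries exhaust the spectrum; if it has n elements, no entry can be
  repeated.\<close>

lemma inj_diagonal_entries:
  fixes B :: "real^'n^'n"
  assumes "\<And>i j. i \<noteq> j \<Longrightarrow> B $ i $ j = 0" "card (eigenvalues B) = CARD('n)" "i \<noteq> j"
  shows "B $ i $ i \<noteq> B $ j $ j"
proof -
  have "card (range (\<lambda>i. complex_of_real (B $ i $ i))) = card (UNIV :: 'n set)"
    using assms(2) eigenvalues_diagonal[OF assms(1)] by simp
  then have "inj (\<lambda>i. complex_of_real (B $ i $ i))" by (simp add: eq_card_imp_inj_on)
  then show ?thesis using assms(3) by (auto simp: inj_def)
qed

text \<open>The one-form in question is minus the differential of ln |G|. Writing it as a quotient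
  avoids a choice of sign for \<open>G\<close>, and closedness reduces to the symmetry of second
  derivatives of \<open>G\<close>, as the other term is symmetric already.\<close>

lemma log_derivative_closed:
  fixes G :: "'a::euclidean_space \<Rightarrow> real"
  assumes G: "smooth_on G S" and "open S" "x \<in> S" and "\<And>y. y \<in> S \<Longrightarrow> G y \<noteq> 0"
  shows "frechet_derivative (\<lambda>y. - (frechet_derivative G (at y) v * inverse (G y))) (at x) w
    = frechet_derivative (\<lambda>y. - (frechet_derivative G (at y) w * inverse (G y))) (at x) v"
proof -
  have "frechet_derivative (\<lambda>y. - (frechet_derivative G (at y) v * inverse (G y))) (at x)
    = (\<lambda>w. - (frechet_derivative G (at x) v * - (inverse (G x) * frechet_derivative G (at x) w * inverse (G x))
         + frechet_derivative (\<lambda>y. frechet_derivative G (at y) v) (at x) w * inverse (G x)))" for v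
    by (rule frechet_derivative_at[symmetric])
      (intro has_derivative_minus has_derivative_mult Deriv.has_derivative_inverse
        smooth_on_has_derivative[OF smooth_on_frechet_derivative[OF G]] smooth_on_has_derivative[OF G] assms)
  then show ?thesis
    by (simp add: second_derivative_symmetric[OF G \<open>open S\<close> \<open>x \<in> S\<close>, of v w] mult_ac)
qed

context smooth_manifold
begin

lemma frechet_derivative_inv_chart_cong:
  assumes c: "c \<in> \<A>" and "open W" "p \<in> fst c" "p \<in> W"
    and eq: "\<And>q. q \<in> fst c \<Longrightarrow> q \<in> W \<Longrightarrow> f q = h (snd c q)" and h: "h differentiable (at (snd c p))"
  shows "frechet_derivative (f \<circ> inv_chart c) (at (snd c p)) = frechet_derivative h (at (snd c p))"
  by (rule frechet_derivative_transform_within_open[OF h open_chart_image[OF c \<open>open W\<close>], symmetric])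
    (use assms in \<open>auto simp: inv_chart_left\<close>)

lemma smooth_K_entry:
  assumes "tensor11_on \<A> UNIV K" "c \<in> \<A>"
  shows "smooth_on (\<lambda>x. K c (inv_chart c x) $ i $ j) (snd c ` fst c)"
  using smooth_components_entry[of UNIV K c] assms by (simp add: tensor11_on_def)

section \<open>Independence of eigenvectors and of the derivatives of eigenvalues from the
  chart\<close>

lemma eigenvector_change_chart:
  assumes K: "tensor11_on \<A> UNIV K" and cd: "c \<in> \<A>" "d \<in> \<A>" and p: "p \<in> fst c" "p \<in> fst d"
    and v: "cmatrix (K c p) *v v = l *s v"
  shows "cmatrix (K d p) *v (cmatrix (jacobian c d p) *v v) = l *s (cmatrix (jacobian c d p) *v v)"
proof -
  have "K d p = jacobian c d p ** K c p ** jacobian d c p"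
    using K cd p unfolding tensor11_on_def by blast
  then have "K d p ** jacobian c d p = jacobian c d p ** K c p ** (jacobian d c p ** jacobian c d p)"
    by (simp add: matrix_mul_assoc)
  then have "K d p ** jacobian c d p = jacobian c d p ** K c p"
    using jacobian_inverse[OF cd(2,1) p(2,1)] by simp
  then have "cmatrix (K d p) *v (cmatrix (jacobian c d p) *v v) = cmatrix (jacobian c d p) *v (cmatrix (K c p) *v v)"
    by (simp add: matrix_vector_mul_assoc flip: cmatrix_mult)
  then show ?thesis by (simp add: v vector_scalar_commute)
qed

lemma eigenvalues_change_chart:
  assumes K: "tensor11_on \<A> UNIV K" and cd: "c \<in> \<A>" "d \<in> \<A>" and p: "p \<in> fst c" "p \<in> fst d"
    and l: "l \<in> eigenvalues (K c p)"
  shows "l \<in> eigenvalues (K d p)"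
proof -
  obtain v where "v \<noteq> 0" and v: "cmatrix (K c p) *v v = l *s v"
    using l by (auto simp: eigenvalues_def)
  have "cmatrix (jacobian d c p) *v (cmatrix (jacobian c d p) *v v) = v"
    by (simp add: matrix_vector_mul_assoc jacobian_inverse[OF cd(2,1) p(2,1)] cmatrix_mat_1 flip: cmatrix_mult)
  then have "cmatrix (jacobian c d p) *v v \<noteq> 0" using \<open>v \<noteq> 0\<close> by (metis matrix_vector_mult_0_right)
  then show ?thesis
    using eigenvector_change_chart[OF K cd p v] unfolding eigenvalues_def by blast
qed

text \<open>Both sides are the complex-linear extension of dl applied to one complexified tangent
  vector: the real chain rule holds on the coordinate vectors and extends linearly. Thus weak
  nonlinearity may be tested in a diagonalising chart.\<close>

lemma pderiv_chart_change_chart: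
  fixes l :: "'m \<Rightarrow> complex"
  assumes cd: "c \<in> \<A>" "d \<in> \<A>" and p: "p \<in> fst c" "p \<in> fst d"
    and l: "(l \<circ> inv_chart c) differentiable (at (snd c p))"
  shows "(\<Sum>i\<in>UNIV. v $ i * pderiv_chart d i l p)
    = (\<Sum>i\<in>UNIV. (cmatrix (jacobian d c p) *v v) $ i * pderiv_chart c i l p)"
proof -
  let ?F = "frechet_derivative (l \<circ> inv_chart c) (at (snd c p))"
  have lin: "linear ?F" by (rule linear_frechet_derivative[OF l])
  have "pderiv_chart d j l p = (\<Sum>i\<in>UNIV. complex_of_real (jacobian d c p $ i $ j) * pderiv_chart c i l p)" for j
  proof -
    have "pderiv_chart d j l p = ?F (jacobian d c p *v axis j 1)"
      unfolding pderiv_chart_def by (rule frechet_derivative_change_chart[OF cd p l])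
    also have "jacobian d c p *v axis j 1 = (\<Sum>i\<in>UNIV. jacobian d c p $ i $ j *\<^sub>R axis i 1)"
      using basis_expansion[of "jacobian d c p *v axis j 1"]
      by (simp add: scalar_mult_eq_scaleR matrix_vector_mult_basis column_def)
    also have "?F (\<Sum>i\<in>UNIV. jacobian d c p $ i $ j *\<^sub>R axis i 1)
        = (\<Sum>i\<in>UNIV. jacobian d c p $ i $ j *\<^sub>R ?F (axis i 1))"
      by (simp only: linear_sum[OF lin] linear_scale[OF lin])
    finally show ?thesis
      by (simp add: pderiv_chart_def scaleR_conv_of_real)
  qed
  then have "(\<Sum>j\<in>UNIV. v $ j * pderiv_chart d j l p)
    = (\<Sum>j\<in>UNIV. \<Sum>i\<in>UNIV. complex_of_real (jacobian d c p $ i $ j) * v $ j * pderiv_chart c i l p)"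
    by (simp add: sum_distrib_left mult_ac)
  also have "\<dots> = (\<Sum>i\<in>UNIV. \<Sum>j\<in>UNIV. complex_of_real (jacobian d c p $ i $ j) * v $ j * pderiv_chart c i l p)"
    by (rule sum.swap)
  finally show ?thesis
    by (simp add: cmatrix_def matrix_vector_mult_def sum_distrib_right)
qed

lemma lower_index_diagonal:
  assumes "\<And>i j. i \<noteq> j \<Longrightarrow> g c q $ i $ j = 0"
  shows "lower_index g K c q $ i $ j = g c q $ i $ i * K c q $ i $ j"
proof -
  have "(\<Sum>s\<in>UNIV. g c q $ s $ i * K c q $ s $ j) = (\<Sum>s\<in>UNIV. if s = i then g c q $ i $ i * K c q $ i $ j else 0)"
    by (rule sum.cong) (use assms in auto)
  then show ?thesis by (simp add: lower_index_def)
qed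

text \<open>The coefficient of v_k v_i^2 in the form is the k-th derivative of T_i = g_i K_i, plus
  K_k - 2 K_i times that of g_i. The product rule turns it into the displayed expression, and the
  coefficients vanish independently.\<close>

lemma killing_form_diagonal:
  assumes g: "metric_on \<A> W g" and K: "tensor11_on \<A> UNIV K" and W: "open W"
    and c: "c \<in> \<A>" and p: "p \<in> fst c" "p \<in> W" and diagK: "diagonal_on c K"
    and diagg: "\<And>q i j. q \<in> fst c \<Longrightarrow> q \<in> W \<Longrightarrow> i \<noteq> j \<Longrightarrow> g c q $ i $ j = 0"
  shows "(\<forall>v. killing_form g K c p v = 0) \<longleftrightarrow> (\<forall>i k.
      g c p $ i $ i * pderiv_chart c k (\<lambda>q. K c q $ i $ i) p
      + pderiv_chart c k (\<lambda>q. g c q $ i $ i) p * (K c p $ k $ k - K c p $ i $ i) = 0)"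
proof -
  let ?x = "snd c p"
  let ?T = "lower_index g K"
  let ?S = "snd c ` (fst c \<inter> W)"
  have g2: "tensor02_on \<A> W g" using g by (simp add: metric_on_def)
  note T2 = tensor02_lower_index[OF g2 K W]
  have comp: "smooth_components \<A> W g" "smooth_components \<A> W ?T"
    using g2 T2 by (auto simp: tensor02_on_def)
  have Kc: "smooth_components \<A> W K"
    using K unfolding tensor11_on_def smooth_components_def by (auto intro: smooth_on_subset)
  have xS: "?x \<in> ?S" using p by blast
  note oS = open_chart_image[OF c W]
  have Tij: "?T c q $ i $ j = g c q $ i $ i * K c q $ i $ j" if "q \<in> fst c" "q \<in> W" for q i j
    by (rule lower_index_diagonal) (use diagg that in blast)
  have diagT: "?T c q $ i $ j = 0" if "q \<in> fst c" "q \<in> W" "i \<noteq> j" for q i j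
    using Tij diagK that by (simp add: diagonal_on_def)
  have lin: "linear (frechet_derivative (h c \<circ> inv_chart c) (at ?x))" if "smooth_components \<A> W h"
    for h :: "('m, 'n) chart \<Rightarrow> 'm \<Rightarrow> real^'n^'n"
    by (rule linear_frechet_derivative, rule smooth_on_differentiable[OF _ xS])
      (use that c in \<open>simp add: smooth_components_def\<close>)
  have off: "frechet_derivative (h c \<circ> inv_chart c) (at ?x) v $ i $ j = 0"
    if "smooth_components \<A> W h" "\<And>q. q \<in> fst c \<Longrightarrow> q \<in> W \<Longrightarrow> h c q $ i $ j = 0"
    for h :: "('m, 'n) chart \<Rightarrow> 'm \<Rightarrow> real^'n^'n" and v i j
    using frechet_derivative_inv_chart_cong[OF c W p, of "\<lambda>q. h c q $ i $ j" "\<lambda>x. 0"] that(2)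
      frechet_derivative_entry[OF that(1) c p, of v i j]
    by (simp add: frechet_derivative_const)
  have diff: "(\<lambda>x. h c (inv_chart c x) $ i $ i) differentiable (at ?x)" if "smooth_components \<A> W h"
    for h :: "('m, 'n) chart \<Rightarrow> 'm \<Rightarrow> real^'n^'n" and i
    by (rule smooth_on_differentiable[OF smooth_components_entry[OF that W c] xS])
  have entry: "frechet_derivative (h c \<circ> inv_chart c) (at ?x) (axis k 1) $ i $ i = pderiv_chart c k (\<lambda>q. h c q $ i $ i) p"
    if "smooth_components \<A> W h" for h :: "('m, 'n) chart \<Rightarrow> 'm \<Rightarrow> real^'n^'n" and i k
    using frechet_derivative_entry[OF that c p] by (simp add: pderiv_chart_def)
  have T_pd: "pderiv_chart c k (\<lambda>q. ?T c q $ i $ i) p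
      = g c p $ i $ i * pderiv_chart c k (\<lambda>q. K c q $ i $ i) p + pderiv_chart c k (\<lambda>q. g c q $ i $ i) p * K c p $ i $ i" for i k
  proof -
    let ?h = "\<lambda>x. g c (inv_chart c x) $ i $ i * K c (inv_chart c x) $ i $ i"
    have "(?h has_derivative (\<lambda>v. g c (inv_chart c ?x) $ i $ i * frechet_derivative (\<lambda>x. K c (inv_chart c x) $ i $ i) (at ?x) v
         + frechet_derivative (\<lambda>x. g c (inv_chart c x) $ i $ i) (at ?x) v * K c (inv_chart c ?x) $ i $ i)) (at ?x)"
      by (intro has_derivative_mult) (use diff comp Kc in \<open>auto simp: frechet_derivative_works\<close>)
    note h = this frechet_derivative_at[OF this, symmetric]
    have "frechet_derivative ((\<lambda>q. ?T c q $ i $ i) \<circ> inv_chart c) (at ?x) = frechet_derivative ?h (at ?x)"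
      by (rule frechet_derivative_inv_chart_cong[OF c W p])
        (use Tij c h(1) in \<open>auto simp: inv_chart_left differentiable_def\<close>)
    then show ?thesis using c p by (simp add: pderiv_chart_def h(2) inv_chart_left o_def)
  qed
  have "killing_form g K c p v = (\<Sum>i\<in>UNIV. \<Sum>k\<in>UNIV. v $ k * (v $ i)\<^sup>2 *
     (g c p $ i $ i * pderiv_chart c k (\<lambda>q. K c q $ i $ i) p
      + pderiv_chart c k (\<lambda>q. g c q $ i $ i) p * (K c p $ k $ k - K c p $ i $ i)))" for v
    unfolding killing_form_def
    by (subst killing_cubic_diagonal)
      (use diagK p diagg diagT in \<open>auto simp: diagonal_on_def entry comp T_pd algebra_simps intro!: lin off comp\<close>)
  then show ?thesis by (simp add: diagonal_cubic_eq_0_iff)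
qed

end

subsection \<open>From separation of variables to (I) and (II)\<close>

lemma isCont_eventually_neq:
  fixes f :: "'a::t2_space \<Rightarrow> 'b::t1_space"
  assumes "isCont f x" "f x \<noteq> a"
  shows "\<forall>\<^sub>F y in nhds x. f y \<noteq> a"
proof -
  have "(f \<longlongrightarrow> f x) (nhds x)"
    using assms(1) tendsto_at_iff_tendsto_nhds[of f x] by (simp add: isCont_def)
  then show ?thesis using assms(2) by (rule tendsto_imp_eventually_ne)
qed

context smooth_manifold
begin

text \<open>In the diagonalising chart T_ij = g_ij K_j, so symmetry of T and of g gives (K_i - K_j)
  g_ij = 0, and distinct eigenvalues make g diagonal. Nondegeneracy then excludes zeros on the
  diagonal, and the Killing equation can be read off entry by entry.\<close>

lemma separation_imp_diagonal_equations:
  assumes K: "tensor11_on \<A> UNIV K" and W: "open W" and g: "metric_on \<A> W g"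
    and sep: "generates_separation_on \<A> W g K"
    and c: "c \<in> \<A>" "fst c \<subseteq> W" and diagK: "diagonal_on c K" and q: "q \<in> fst c"
  shows "\<And>i j. i \<noteq> j \<Longrightarrow> K c q $ i $ i \<noteq> K c q $ j $ j"
    and "\<And>i. g c q $ i $ i \<noteq> 0"
    and "\<And>i k. g c q $ i $ i * pderiv_chart c k (\<lambda>q. K c q $ i $ i) q
      + pderiv_chart c k (\<lambda>q. g c q $ i $ i) q * (K c q $ k $ k - K c q $ i $ i) = 0"
proof -
  have dist: "K c r $ i $ i \<noteq> K c r $ j $ j" if "r \<in> fst c" "i \<noteq> j" for r i j
  proof (rule inj_diagonal_entries[OF _ _ that(2)])
    show "card (eigenvalues (K c r)) = CARD('n)"
      using sep c that by (auto simp: generates_separation_on_def distinct_eigenvalues_on_def)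
  qed (use diagK that in \<open>auto simp: diagonal_on_def\<close>)
  have kill: "killing_on \<A> W g (lower_index g K)"
    using sep by (simp add: generates_separation_on_def)
  have sym: "lower_index g K c r $ i $ j = lower_index g K c r $ j $ i" if "r \<in> fst c" for r i j
    using kill c that unfolding killing_on_def by blast
  have lower: "lower_index g K c r $ i $ j = g c r $ j $ i * K c r $ j $ j" if "r \<in> fst c" for r i j
  proof -
    have "(\<Sum>s\<in>UNIV. g c r $ s $ i * K c r $ s $ j) = (\<Sum>s\<in>UNIV. if s = j then g c r $ j $ i * K c r $ j $ j else 0)"
      by (rule sum.cong) (use diagK that in \<open>auto simp: diagonal_on_def\<close>)
    then show ?thesis by (simp add: lower_index_def)
  qed
  have symg: "g c r $ i $ j = g c r $ j $ i" if "r \<in> fst c" for r i j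
  proof -
    have "transpose (g c r) = g c r" using g c that by (auto simp: metric_on_def)
    moreover have "transpose (g c r) $ j $ i = g c r $ i $ j" by (simp add: transpose_def)
    ultimately show ?thesis by simp
  qed
  have diagg: "g c r $ i $ j = 0" if "r \<in> fst c" "i \<noteq> j" for r i j
    using sym[OF that(1), of i j] symg[OF that(1), of i j] dist[OF that]
    by (simp add: lower[OF that(1)])
  show "K c q $ i $ i \<noteq> K c q $ j $ j" if "i \<noteq> j" for i j using dist[OF q that] .
  show "g c q $ i $ i \<noteq> 0" for i
  proof
    assume "g c q $ i $ i = 0"
    then have "g c q $ j $ i = 0" for j using diagg[OF q, of j i] by (cases "j = i") auto
    then have "g c q *v axis i 1 = 0"
      by (simp add: matrix_vector_mult_basis column_def vec_eq_iff)
    moreover have "invertible (g c q)" using g c q by (auto simp: metric_on_def)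
    ultimately have "axis i (1::real) = (0 :: real^'n)"
      by (metis invertible_def matrix_vector_mul_assoc matrix_vector_mul_lid matrix_vector_mult_0_right)
    then show False by (simp add: axis_eq_0_iff)
  qed
  have "\<forall>v. killing_form g K c q v = 0"
    by (subst killing_equation_iff[OF g K W c(1), symmetric])
      (use q c kill sym in \<open>auto simp: killing_on_def transpose_def vec_eq_iff\<close>)
  moreover have "(\<forall>v. killing_form g K c q v = 0) \<longleftrightarrow> (\<forall>i k.
      g c q $ i $ i * pderiv_chart c k (\<lambda>q. K c q $ i $ i) q
      + pderiv_chart c k (\<lambda>q. g c q $ i $ i) q * (K c q $ k $ k - K c q $ i $ i) = 0)"
    by (rule killing_form_diagonal[OF g K W c(1) q _ diagK]) (use diagg c(2) q in auto)
  ultimately show "g c q $ i $ i * pderiv_chart c k (\<lambda>q. K c q $ i $ i) q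
      + pderiv_chart c k (\<lambda>q. g c q $ i $ i) q * (K c q $ k $ k - K c q $ i $ i) = 0" for i k
    by simp
qed

text \<open>The eigenvalue function \<open>l\<close> is an arbitrary smooth complex-valued one and
  is given without reference to the diagonalising chart. It has to be identified near
  \<open>p\<close> with a single diagonal entry before the equation with k = i can be applied to
  it.\<close>

lemma separation_imp_weakly_nonlinear:
  assumes K: "tensor11_on \<A> UNIV K"
    and ex: "\<forall>p. \<exists>W g. open W \<and> p \<in> W \<and> metric_on \<A> W g \<and> generates_separation_on \<A> W g K"
  shows "weakly_nonlinear \<A> K"
  unfolding weakly_nonlinear_def
proof (clarify)
  fix V and l :: "'m \<Rightarrow> complex" and d p and v :: "complex^'n"
  assume V: "open V" and l: "smooth_map_on \<A> V l"
    and ev: "\<forall>c\<in>\<A>. \<forall>q\<in>fst c \<inter> V. l q \<in> eigenvalues (K c q)"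
    and d: "d \<in> \<A>" and p: "p \<in> fst d" "p \<in> V" and v: "cmatrix (K d p) *v v = l p *s v"
  obtain W g where W: "open W" "p \<in> W" and g: "metric_on \<A> W g" and sep: "generates_separation_on \<A> W g K"
    using ex by blast
  obtain c where c: "c \<in> \<A>" "p \<in> fst c" "fst c \<subseteq> W" and diagK: "diagonal_on c K"
    using sep W unfolding generates_separation_on_def by blast
  note eqs = separation_imp_diagonal_equations[OF K W(1) g sep c(1,3) diagK]
  let ?x = "snd c p"
  let ?S = "snd c ` (fst c \<inter> V)"
  have oS: "open ?S" by (rule open_chart_image[OF c(1) V])
  have xS: "?x \<in> ?S" using c p by blast
  have sml: "smooth_on (l \<circ> inv_chart c) ?S" using l c by (simp add: smooth_map_on_def)
  have dl: "(l \<circ> inv_chart c) differentiable (at ?x)" by (rule smooth_on_differentiable[OF sml xS])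
  have smK: "smooth_on (\<lambda>x. K c (inv_chart c x) $ i $ i) (snd c ` fst c)" for i
    by (rule smooth_K_entry[OF K c(1)])
  have l_mem: "\<exists>i. l q = complex_of_real (K c q $ i $ i)" if "q \<in> fst c" "q \<in> V" for q
  proof -
    have "l q \<in> eigenvalues (K c q)" using ev that c by blast
    also have "eigenvalues (K c q) = range (\<lambda>i. complex_of_real (K c q $ i $ i))"
      by (rule eigenvalues_diagonal) (use that diagK in \<open>auto simp: diagonal_on_def\<close>)
    finally show ?thesis by blast
  qed
  define w where "w = cmatrix (jacobian d c p) *v v"
  have w: "cmatrix (K c p) *v w = l p *s w"
    unfolding w_def by (rule eigenvector_change_chart[OF K d c(1) p(1) c(2) v])
  \<comment> \<open>Only an index whose diagonal entry equals the eigenvalue can contribute to the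
    sum; the derivative of \<open>l\<close> matters in that direction alone.\<close>
  have wi: "w $ i = 0 \<or> l p = complex_of_real (K c p $ i $ i)" for i
  proof -
    have "(cmatrix (K c p) *v w) $ i = complex_of_real (K c p $ i $ i) * w $ i"
      by (rule cmatrix_diagonal_mult_vec) (use diagK c in \<open>auto simp: diagonal_on_def\<close>)
    then have "complex_of_real (K c p $ i $ i) * w $ i = l p * w $ i"
      by (simp only: w vector_smult_component)
    then show ?thesis by (metis mult_right_cancel)
  qed
  have term0: "w $ i * pderiv_chart c i l p = 0" for i
  proof (cases "w $ i = 0")
    case False
    then have li: "l p = complex_of_real (K c p $ i $ i)" using wi by blast
    text \<open>The other diagonal entries stay away from \<open>l\<close> near \<open>p\<close>, so \<open>l\<close> is the \<open>i\<close>-th entry there.\<close>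
    have "\<forall>\<^sub>F x in nhds ?x. \<forall>a\<in>UNIV - {i}. complex_of_real (K c (inv_chart c x) $ a $ a) - l (inv_chart c x) \<noteq> 0"
    proof (rule eventually_ball_finite, simp, intro ballI)
      fix a assume a: "a \<in> UNIV - {i}"
      have contK: "continuous_on ?S (\<lambda>x. K c (inv_chart c x) $ a $ a)"
        by (rule continuous_on_subset[OF smooth_on_continuous[OF smK]]) auto
      have contl: "continuous_on ?S (\<lambda>x. l (inv_chart c x))"
        using smooth_on_continuous[OF sml] by (simp add: o_def)
      have "continuous_on ?S (\<lambda>x. complex_of_real (K c (inv_chart c x) $ a $ a) - l (inv_chart c x))"
        by (intro continuous_on_diff continuous_on_of_real contK contl)
      then have "isCont (\<lambda>x. complex_of_real (K c (inv_chart c x) $ a $ a) - l (inv_chart c x)) ?x"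
        using oS xS continuous_on_eq_continuous_at by blast
      moreover have "complex_of_real (K c (inv_chart c ?x) $ a $ a) - l (inv_chart c ?x) \<noteq> 0"
        using eqs(1)[OF c(2), of a i] a li c by (simp add: inv_chart_left)
      ultimately show "\<forall>\<^sub>F x in nhds ?x. complex_of_real (K c (inv_chart c x) $ a $ a) - l (inv_chart c x) \<noteq> 0"
        by (rule isCont_eventually_neq)
    qed
    then have "\<forall>\<^sub>F x in nhds ?x. x \<in> ?S \<and>
      (\<forall>a\<in>UNIV - {i}. complex_of_real (K c (inv_chart c x) $ a $ a) - l (inv_chart c x) \<noteq> 0)"
      using eventually_nhds_in_open[OF oS xS] by eventually_elim auto
    then obtain N where N: "open N" "?x \<in> N" and
      Nl: "\<And>x. x \<in> N \<Longrightarrow> x \<in> ?S \<and> (\<forall>a\<in>UNIV - {i}. complex_of_real (K c (inv_chart c x) $ a $ a) - l (inv_chart c x) \<noteq> 0)"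
      unfolding eventually_nhds by blast
    have eq: "(l \<circ> inv_chart c) x = complex_of_real (K c (inv_chart c x) $ i $ i)" if xN: "x \<in> N" for x
    proof -
      obtain q where q: "x = snd c q" "q \<in> fst c" "q \<in> V" using Nl[OF xN] by blast
      then obtain a where "l q = complex_of_real (K c q $ a $ a)" using l_mem by blast
      then show ?thesis using Nl[OF xN] q c by (cases "a = i") (auto simp: inv_chart_left)
    qed
    have "((\<lambda>x. K c (inv_chart c x) $ i $ i) has_derivative
        frechet_derivative (\<lambda>x. K c (inv_chart c x) $ i $ i) (at ?x)) (at ?x)"
      by (rule smooth_on_has_derivative[OF smK]) (use c in auto)
    from bounded_linear.has_derivative[OF bounded_linear_of_real this]
    have "((l \<circ> inv_chart c) has_derivative
       (\<lambda>u. complex_of_real (frechet_derivative (\<lambda>x. K c (inv_chart c x) $ i $ i) (at ?x) u))) (at ?x)"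
      by (rule has_derivative_transform_within_open[OF _ N]) (rule eq[symmetric])
    from frechet_derivative_at[OF this, symmetric]
    have "pderiv_chart c i l p = complex_of_real (pderiv_chart c i (\<lambda>q. K c q $ i $ i) p)"
      by (simp add: pderiv_chart_def o_def)
    \<comment> \<open>For k = i the factor K_k - K_i vanishes, leaving g_i times the wanted
      derivative, with g_i nonzero.\<close>
    also have "\<dots> = 0" using eqs(2)[OF c(2), of i] eqs(3)[OF c(2), of i i] by simp
    finally show ?thesis by simp
  qed simp
  show "(\<Sum>i\<in>UNIV. v $ i * pderiv_chart d i l p) = 0"
    unfolding pderiv_chart_change_chart[OF c(1) d c(2) p(1) dl, of v] w_def[symmetric]
    by (rule sum.neutral) (use term0 in blast)
qed

text \<open>By the diagonal equations the expression differentiated in the semi-hamiltonian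
  condition is, on the whole chart, the j-th derivative of -ln |g_i|. The condition therefore says
  that mixed second derivatives of ln |g_i| commute.\<close>

lemma separation_imp_semi_hamiltonian:
  assumes K: "tensor11_on \<A> UNIV K"
    and ex: "\<forall>p. \<exists>W g. open W \<and> p \<in> W \<and> metric_on \<A> W g \<and> generates_separation_on \<A> W g K"
  shows "semi_hamiltonian \<A> K"
  unfolding semi_hamiltonian_def
proof
  fix p
  obtain W g where W: "open W" "p \<in> W" and g: "metric_on \<A> W g" and sep: "generates_separation_on \<A> W g K"
    using ex by blast
  obtain c where c: "c \<in> \<A>" "p \<in> fst c" "fst c \<subseteq> W" and diagK: "diagonal_on c K"
    using sep W unfolding generates_separation_on_def by blast
  note eqs = separation_imp_diagonal_equations[OF K W(1) g sep c(1,3) diagK]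
  let ?S = "snd c ` fst c"
  have oS: "open ?S" using open_overlap[OF c(1,1)] by simp
  define G where "G i = (\<lambda>q. g c q $ i $ i) \<circ> inv_chart c" for i :: 'n
  have smG: "smooth_on (G i) ?S" for i
  proof -
    have "smooth_components \<A> W g" using g by (simp add: metric_on_def tensor02_on_def)
    from smooth_components_entry[OF this W(1) c(1)] show ?thesis
      using c(3) by (simp add: G_def o_def Int_absorb2)
  qed
  have G0: "G i x \<noteq> 0" if "x \<in> ?S" for i x
    using eqs(2) that c(1) by (auto simp: G_def inv_chart_left)
  have F: "pderiv_chart c k (\<lambda>r. 1 / (K c r $ j $ j - K c r $ i $ i) * pderiv_chart c j (\<lambda>s. K c s $ i $ i) r) q
      = frechet_derivative (\<lambda>y. - (frechet_derivative (G i) (at y) (axis j 1) * inverse (G i y))) (at (snd c q)) (axis k 1)"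
    if q: "q \<in> fst c" and "i \<noteq> j" for i j k :: 'n and q
  proof -
    have "frechet_derivative ((\<lambda>r. 1 / (K c r $ j $ j - K c r $ i $ i) * pderiv_chart c j (\<lambda>s. K c s $ i $ i) r) \<circ> inv_chart c) (at (snd c q))
      = frechet_derivative (\<lambda>y. - (frechet_derivative (G i) (at y) (axis j 1) * inverse (G i y))) (at (snd c q))"
    proof (rule frechet_derivative_inv_chart_cong[OF c(1) open_UNIV q])
      fix r assume r: "r \<in> fst c"
      have "frechet_derivative (G i) (at (snd c r)) (axis j 1) = pderiv_chart c j (\<lambda>q. g c q $ i $ i) r"
        by (simp add: G_def pderiv_chart_def)
      then show "1 / (K c r $ j $ j - K c r $ i $ i) * pderiv_chart c j (\<lambda>s. K c s $ i $ i) r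
          = - (frechet_derivative (G i) (at (snd c r)) (axis j 1) * inverse (G i (snd c r)))"
        using eqs(1)[OF r \<open>i \<noteq> j\<close>] eqs(2)[OF r, of i] eqs(3)[OF r, of i j] r c(1)
        by (simp add: G_def inv_chart_left field_simps)
    next
      show "(\<lambda>y. - (frechet_derivative (G i) (at y) (axis j 1) * inverse (G i y))) differentiable (at (snd c q))"
        by (rule smooth_on_differentiable[where S = ?S])
          (use q G0 in \<open>auto intro!: smooth_on_minus smooth_on_mult smooth_on_inverse smooth_on_frechet_derivative smG oS\<close>)
    qed simp
    then show ?thesis by (simp add: pderiv_chart_def)
  qed
  show "\<exists>c\<in>\<A>. p \<in> fst c \<and> diagonal_on c K \<and>
        (\<forall>i j k. i \<noteq> j \<and> j \<noteq> k \<and> i \<noteq> k \<longrightarrow> (\<forall>q \<in> fst c.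
           pderiv_chart c k
             (\<lambda>r. 1 / (K c r $ j $ j - K c r $ i $ i) * pderiv_chart c j (\<lambda>s. K c s $ i $ i) r) q
         = pderiv_chart c j
             (\<lambda>r. 1 / (K c r $ k $ k - K c r $ i $ i) * pderiv_chart c k (\<lambda>s. K c s $ i $ i) r) q))"
  proof (intro bexI[OF _ c(1)] conjI allI impI ballI)
    fix i j k :: 'n and q assume ijk: "i \<noteq> j \<and> j \<noteq> k \<and> i \<noteq> k" and q: "q \<in> fst c"
    show "pderiv_chart c k (\<lambda>r. 1 / (K c r $ j $ j - K c r $ i $ i) * pderiv_chart c j (\<lambda>s. K c s $ i $ i) r) q
      = pderiv_chart c j (\<lambda>r. 1 / (K c r $ k $ k - K c r $ i $ i) * pderiv_chart c k (\<lambda>s. K c s $ i $ i) r) q"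
      unfolding F[OF q conjunct1[OF ijk]] F[OF q conjunct2[OF conjunct2[OF ijk]]]
      by (rule log_derivative_closed[OF smG oS _ G0]) (use q in auto)
  qed (use c diagK in auto)
qed

text \<open>The i-th diagonal entry in the chart \<open>c\<close>, regarded as a function on its
  domain, is an admissible eigenvalue function with eigenvector \<open>axis i 1\<close>. Most of the
  work is to see that it is smooth and an eigenvalue in all other charts as well, as
  \<open>weakly_nonlinear\<close> demands.\<close>

lemma weakly_nonlinear_diagonal:
  assumes K: "tensor11_on \<A> UNIV K" and wn: "weakly_nonlinear \<A> K"
    and c: "c \<in> \<A>" and diagK: "diagonal_on c K" and q: "q \<in> fst c"
  shows "pderiv_chart c i (\<lambda>q. K c q $ i $ i) q = 0"
proof -
  define l where "l q = complex_of_real (K c q $ i $ i)" for q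
  have "smooth_map_on \<A> (fst c) l"
    unfolding smooth_map_on_def
  proof
    fix d assume d: "d \<in> \<A>"
    have "smooth_on (\<lambda>x. K c (inv_chart c ((snd c \<circ> inv_chart d) x)) $ i $ i) (snd d ` (fst d \<inter> fst c))"
      by (rule smooth_on_compose[OF open_overlap[OF d c] smooth_transition[OF d c] smooth_K_entry[OF K c]])
        (use d in \<open>auto simp: inv_chart_left\<close>)
    from smooth_on_bounded_linear[OF bounded_linear_of_real open_overlap[OF d c] this]
    have "smooth_on (\<lambda>x. complex_of_real (K c (inv_chart c ((snd c \<circ> inv_chart d) x)) $ i $ i)) (snd d ` (fst d \<inter> fst c))" .
    then show "smooth_on (l \<circ> inv_chart d) (snd d ` (fst d \<inter> fst c))"
      by (rule smooth_on_cong[OF open_overlap[OF d c], THEN iffD1, rotated])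
        (use c d in \<open>auto simp: l_def inv_chart_left\<close>)
  qed
  moreover have "l q \<in> eigenvalues (K d q)" if "d \<in> \<A>" "q \<in> fst d \<inter> fst c" for d q
  proof (rule eigenvalues_change_chart[OF K c that(1)])
    show "l q \<in> eigenvalues (K c q)"
      using eigenvalues_diagonal[of "K c q"] diagK that by (auto simp: diagonal_on_def l_def)
  qed (use that in auto)
  moreover have "cmatrix (K c q) *v axis i 1 = l q *s axis i 1"
  proof -
    have "(cmatrix (K c q) *v axis i 1) $ j = (l q *s axis i 1) $ j" for j
      using cmatrix_diagonal_mult_vec[of "K c q" "axis i 1" j] diagK q
      by (simp add: diagonal_on_def l_def axis_def)
    then show ?thesis by (simp add: vec_eq_iff)
  qed
  ultimately have "(\<Sum>j\<in>UNIV. axis i 1 $ j * pderiv_chart c j l q) = 0"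
    using wn open_chart[OF c] c q unfolding weakly_nonlinear_def by blast
  moreover have "(\<Sum>j\<in>UNIV. axis i 1 $ j * pderiv_chart c j l q) = (\<Sum>j\<in>UNIV. if j = i then pderiv_chart c i l q else 0)"
    by (rule sum.cong) (auto simp: axis_def)
  ultimately have "pderiv_chart c i l q = 0" by simp
  moreover have "((\<lambda>x. K c (inv_chart c x) $ i $ i) has_derivative
      frechet_derivative (\<lambda>x. K c (inv_chart c x) $ i $ i) (at (snd c q))) (at (snd c q))"
    by (rule smooth_on_has_derivative[OF smooth_K_entry[OF K c]]) (use q in auto)
  from bounded_linear.has_derivative[OF bounded_linear_of_real this]
  have "((l \<circ> inv_chart c) has_derivative
      (\<lambda>v. complex_of_real (frechet_derivative (\<lambda>x. K c (inv_chart c x) $ i $ i) (at (snd c q)) v))) (at (snd c q))"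
    by (simp add: l_def o_def)
  from frechet_derivative_at[OF this, symmetric]
  have "pderiv_chart c i l q = complex_of_real (pderiv_chart c i (\<lambda>q. K c q $ i $ i) q)"
    by (simp add: pderiv_chart_def o_def)
  ultimately show ?thesis by simp
qed

end

subsection \<open>Construction of the metric\<close>

text \<open>The \<open>i\<close>-th component of \<open>\<omega>\<close> is irrelevant: the coordinate \<open>x\<^sub>i\<close> is a parameter.\<close>

lemma poincare_without_coordinate:
  fixes \<omega> :: "'n \<Rightarrow> real^'n \<Rightarrow> real"
  assumes sm: "\<And>j. j \<noteq> i \<Longrightarrow> smooth_on (\<omega> j) (ball x0 r)"
    and closed: "\<And>x j k. x \<in> ball x0 r \<Longrightarrow> j \<noteq> i \<Longrightarrow> k \<noteq> i \<Longrightarrow> j \<noteq> k \<Longrightarrow>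
      frechet_derivative (\<omega> j) (at x) (axis k 1) = frechet_derivative (\<omega> k) (at x) (axis j 1)"
  obtains f where "smooth_on f (ball x0 r)"
    "\<And>x j. x \<in> ball x0 r \<Longrightarrow> j \<noteq> i \<Longrightarrow> frechet_derivative f (at x) (axis j 1) = \<omega> j x"
proof -
  \<comment> \<open>The orthogonal projection along the i-th axis: its leaves are the hyperplanes
    x_i = const, and the complementary projection does not increase norms.\<close>
  define P :: "real^'n \<Rightarrow> real^'n" where "P v = (\<chi> j. if j = i then 0 else v $ j)" for v
  \<comment> \<open>No smoothness is assumed of \<open>\<omega> i\<close>; replacing it by 0 gives a
    smooth field without affecting the values on the leaves.\<close>
  define w where "w x = (\<chi> j. if j = i then 0 else \<omega> j x)" for x
  have smw: "smooth_on w (ball x0 r)"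
    unfolding w_def
  proof (rule smooth_on_vec_lambda[OF open_ball])
    show "smooth_on (\<lambda>x. if j = i then 0 else \<omega> j x) (ball x0 r)" for j
      by (cases "j = i") (simp_all add: sm smooth_on_const)
  qed
  have dw: "frechet_derivative w (at x) v $ j = (if j = i then 0 else frechet_derivative (\<omega> j) (at x) v)"
    if "x \<in> ball x0 r" for x v j
    using frechet_derivative_vec_nth[OF smooth_on_differentiable[OF smw that], of j v]
    by (auto simp: w_def frechet_derivative_const)
  have lin: "linear (frechet_derivative w (at x))" if "x \<in> ball x0 r" for x
    by (rule linear_frechet_derivative[OF smooth_on_differentiable[OF smw that]])
  have "linear P" by (rule linearI) (auto simp: P_def vec_eq_iff)
  then have P: "bounded_linear P" by (simp add: linear_conv_bounded_linear)
  have expand: "frechet_derivative w (at x) (P a) \<bullet> P b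
      = (\<Sum>j\<in>UNIV. \<Sum>k\<in>UNIV. P a $ k * P b $ j * frechet_derivative w (at x) (axis k 1) $ j)"
    if "x \<in> ball x0 r" for x a b
    unfolding linear_expand_axis[OF lin[OF that], of "P a"]
    by (simp add: inner_vec_def sum_distrib_left mult_ac)
  obtain f where f: "smooth_on f (ball x0 r)"
    "\<And>x v. x \<in> ball x0 r \<Longrightarrow> frechet_derivative f (at x) (P v) = w x \<bullet> P v"
  proof (rule poincare_along_projection[OF smw P])
    show "P (P v) = P v" for v by (simp add: P_def vec_eq_iff)
    show "norm (v - P v) \<le> norm v" for v
    proof -
      have "v - P v = axis i (v $ i)" by (simp add: P_def vec_eq_iff axis_def)
      moreover have "norm (axis i (v $ i)) = \<bar>v $ i\<bar>"
        by (simp add: norm_eq_sqrt_inner inner_axis_axis)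
      ultimately show ?thesis using component_le_norm_cart[of v i] by simp
    qed
    show "frechet_derivative w (at x) (P a) \<bullet> P b = frechet_derivative w (at x) (P b) \<bullet> P a"
      if x: "x \<in> ball x0 r" for x a b
    proof -
      have "(\<Sum>j\<in>UNIV. \<Sum>k\<in>UNIV. P a $ k * P b $ j * frechet_derivative w (at x) (axis k 1) $ j)
        = (\<Sum>j\<in>UNIV. \<Sum>k\<in>UNIV. P a $ k * P b $ j * frechet_derivative w (at x) (axis j 1) $ k)"
      proof (intro sum.cong refl)
        fix j k
        show "P a $ k * P b $ j * frechet_derivative w (at x) (axis k 1) $ j
          = P a $ k * P b $ j * frechet_derivative w (at x) (axis j 1) $ k"
        \<comment> \<open>Terms involving the index i are annihilated by \<open>P\<close>, and for j
          = k both sides are the same; only genuinely mixed terms call for the closedness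
          hypothesis.\<close>
        proof (cases "j = i \<or> k = i \<or> j = k")
          case True
          then show ?thesis by (auto simp: P_def)
        next
          case False
          then show ?thesis using closed[OF x, of j k] by (simp add: dw[OF x])
        qed
      qed
      also have "\<dots> = (\<Sum>k\<in>UNIV. \<Sum>j\<in>UNIV. P b $ j * P a $ k * frechet_derivative w (at x) (axis j 1) $ k)"
        by (subst sum.swap) (simp add: mult_ac)
      finally show ?thesis by (simp only: expand[OF x])
    qed
  qed blast
  show ?thesis
  proof (rule that[OF f(1)])
    fix x j assume x: "x \<in> ball x0 r" and j: "j \<noteq> i"
    have "P (axis j 1) = axis j 1" using j by (auto simp: P_def vec_eq_iff axis_def)
    then have "frechet_derivative f (at x) (axis j 1) = w x \<bullet> axis j 1" using f(2)[OF x, of "axis j 1"] by simp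
    also have "\<dots> = \<omega> j x" using j by (simp add: inner_axis w_def)
    finally show "frechet_derivative f (at x) (axis j 1) = \<omega> j x" .
  qed
qed

context smooth_manifold
begin

section \<open>Metrics prescribed in a single chart\<close>

lemma smooth_jacobian_entry:
  assumes cd: "c \<in> \<A>" "d \<in> \<A>"
  shows "smooth_on (\<lambda>x. jacobian d c (inv_chart d x) $ a $ i) (snd d ` (fst d \<inter> fst c))"
proof -
  note o = open_overlap[OF cd(2,1)]
  have "smooth_on (\<lambda>x. frechet_derivative (\<lambda>y. (snd c \<circ> inv_chart d) y $ a) (at x) (axis i 1)) (snd d ` (fst d \<inter> fst c))"
    by (intro smooth_on_frechet_derivative smooth_on_vec_nth o smooth_transition cd)
  then show ?thesis
    by (rule smooth_on_cong[OF o, THEN iffD1, rotated])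
      (use cd in \<open>auto simp: jacobian_def pderiv_chart_def o_def inv_chart_left\<close>)
qed

text \<open>A metric has components in every chart, so the diagonal matrix given in \<open>c\<close>
  is pulled back by the Jacobians from all charts \<open>d\<close>. As \<open>W\<close> lies in the
  domain of \<open>c\<close>, these Jacobians are invertible at the points concerned, and the
  transformation law is the chain rule for them.\<close>

lemma diagonal_metric:
  fixes f :: "'n \<Rightarrow> real^'n \<Rightarrow> real"
  assumes c: "c \<in> \<A>" and W: "open W" "W \<subseteq> fst c"
    and f: "\<And>i. smooth_on (f i) (snd c ` W)" and f0: "\<And>i x. x \<in> snd c ` W \<Longrightarrow> f i x \<noteq> 0"
  obtains g where "metric_on \<A> W g"
    "\<And>q i j. q \<in> W \<Longrightarrow> g c q $ i $ j = (if i = j then f i (snd c q) else 0)"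
proof -
  define D :: "'m \<Rightarrow> real^'n^'n" where "D q = (\<chi> i j. if i = j then f i (snd c q) else 0)" for q
  define g where "g d q = transpose (jacobian d c q) ** D q ** jacobian d c q" for d :: "('m, 'n) chart" and q
  have comp: "g c q $ i $ j = (if i = j then f i (snd c q) else 0)" if "q \<in> W" for q i j
    using that W c by (auto simp: g_def D_def jacobian_refl transpose_mat subset_iff)
  have entry: "g d q $ i $ j = (\<Sum>a\<in>UNIV. jacobian d c q $ a $ i * f a (snd c q) * jacobian d c q $ a $ j)" for d q i j
  proof -
    have "(\<Sum>a\<in>UNIV. jacobian d c q $ a $ i * (if a = k then f a (snd c q) else 0)) = jacobian d c q $ k $ i * f k (snd c q)" for k
    proof -
      have "(\<Sum>a\<in>UNIV. jacobian d c q $ a $ i * (if a = k then f a (snd c q) else 0))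
          = (\<Sum>a\<in>UNIV. if a = k then jacobian d c q $ k $ i * f k (snd c q) else 0)"
        by (rule sum.cong) auto
      then show ?thesis by simp
    qed
    then show ?thesis by (simp add: g_def D_def matrix_matrix_mult_def transpose_def)
  qed
  have "metric_on \<A> W g"
    unfolding metric_on_def tensor02_on_def smooth_components_def
  proof (intro conjI ballI)
    fix d assume d: "d \<in> \<A>"
    let ?N = "snd d ` (fst d \<inter> W)"
    have o: "open ?N" by (rule open_chart_image[OF d W(1)])
    have sub: "?N \<subseteq> snd d ` (fst d \<inter> fst c)" using W by auto
    have smf: "smooth_on (\<lambda>x. f a ((snd c \<circ> inv_chart d) x)) ?N" for a
      by (rule smooth_on_compose[OF o smooth_on_subset[OF smooth_transition[OF d c] sub] f])
        (use d in \<open>auto simp: inv_chart_left\<close>)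
    have "smooth_on (\<lambda>x. \<chi> i j. \<Sum>a\<in>UNIV. jacobian d c (inv_chart d x) $ a $ i * f a ((snd c \<circ> inv_chart d) x) *
        jacobian d c (inv_chart d x) $ a $ j) ?N"
      by (intro smooth_on_vec_lambda smooth_on_sum smooth_on_mult o smf
          smooth_on_subset[OF smooth_jacobian_entry[OF c d] sub])
    moreover have "g d \<circ> inv_chart d = (\<lambda>x. \<chi> i j. \<Sum>a\<in>UNIV. jacobian d c (inv_chart d x) $ a $ i *
        f a ((snd c \<circ> inv_chart d) x) * jacobian d c (inv_chart d x) $ a $ j)"
      by (simp add: fun_eq_iff vec_eq_iff entry)
    ultimately show "smooth_on (g d \<circ> inv_chart d) ?N" by simp
  next
    fix d e q assume de: "d \<in> \<A>" "e \<in> \<A>" and q: "q \<in> fst d \<inter> fst e \<inter> W"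
    have "jacobian e c q = jacobian d c q ** jacobian e d q"
      using jacobian_chain[OF de(2,1) c] q W by auto
    then show "g e q = transpose (jacobian e d q) ** g d q ** jacobian e d q"
      by (simp add: g_def matrix_transpose_mul matrix_mul_assoc)
  next
    fix d q assume d: "d \<in> \<A>" and q: "q \<in> fst d \<inter> W"
    show "transpose (g d q) = g d q"
      by (simp add: transpose_def vec_eq_iff entry mult_ac)
    have "q \<in> fst d" "q \<in> fst c" using q W by auto
    then have "jacobian d c q ** jacobian c d q = mat 1" "jacobian c d q ** jacobian d c q = mat 1"
      using jacobian_inverse c d by blast+
    then have "invertible (jacobian d c q)" unfolding invertible_def by blast
    moreover have "invertible (D q)"
    proof -
      have "det (D q) = (\<Prod>i\<in>UNIV. f i (snd c q))"
        by (subst det_diagonal) (auto simp: D_def)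
      also have "\<dots> \<noteq> 0" using f0 q by auto
      finally show ?thesis by (simp add: invertible_det_nz)
    qed
    ultimately show "invertible (g d q)"
      unfolding g_def by (intro invertible_mult transpose_invertible)
  qed
  then show ?thesis using comp by (rule that)
qed

text \<open>Integrating the prescribed logarithmic derivatives one index i at a time gives a
  diagonal metric on a coordinate ball. The Killing equation is verified there in the diagonalising
  chart and carried to all others by the invariance of the cubic form.\<close>

lemma semi_hamiltonian_imp_separation:
  assumes K: "tensor11_on \<A> UNIV K" and dist: "distinct_eigenvalues_on \<A> UNIV K"
    and wn: "weakly_nonlinear \<A> K" and sh: "semi_hamiltonian \<A> K"
  shows "\<exists>W g. open W \<and> p \<in> W \<and> metric_on \<A> W g \<and> generates_separation_on \<A> W g K"
proof -
  obtain c where c: "c \<in> \<A>" "p \<in> fst c" and diagK: "diagonal_on c K"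
    and ham: "\<And>i j k q. i \<noteq> j \<Longrightarrow> j \<noteq> k \<Longrightarrow> i \<noteq> k \<Longrightarrow> q \<in> fst c \<Longrightarrow>
      pderiv_chart c k (\<lambda>r. 1 / (K c r $ j $ j - K c r $ i $ i) * pderiv_chart c j (\<lambda>s. K c s $ i $ i) r) q
      = pderiv_chart c j (\<lambda>r. 1 / (K c r $ k $ k - K c r $ i $ i) * pderiv_chart c k (\<lambda>s. K c s $ i $ i) r) q"
    using sh unfolding semi_hamiltonian_def by meson
  let ?S = "snd c ` fst c"
  have oS: "open ?S" using open_overlap[OF c(1,1)] by simp
  have neq: "K c q $ i $ i \<noteq> K c q $ j $ j" if "q \<in> fst c" "i \<noteq> j" for q i j
    by (rule inj_diagonal_entries[OF _ _ that(2)])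
      (use dist diagK c that in \<open>auto simp: distinct_eigenvalues_on_def diagonal_on_def\<close>)
  define \<kappa> where "\<kappa> i = (\<lambda>s. K c s $ i $ i) \<circ> inv_chart c" for i
  have sm\<kappa>: "smooth_on (\<kappa> i) ?S" for i
    using smooth_K_entry[OF K c(1)] by (simp add: \<kappa>_def o_def)
  have neq\<kappa>: "\<kappa> j x - \<kappa> i x \<noteq> 0" if "x \<in> ?S" "i \<noteq> j" for x i j
    using that neq c(1) by (auto simp: \<kappa>_def inv_chart_left)
  define b where "b i j x = inverse (\<kappa> j x - \<kappa> i x) * frechet_derivative (\<kappa> i) (at x) (axis j 1)" for i j x
  have smb: "smooth_on (b i j) ?S" if "i \<noteq> j" for i j
    unfolding b_def
    by (intro smooth_on_mult smooth_on_inverse smooth_on_diff smooth_on_frechet_derivative sm\<kappa> oS neq\<kappa> that)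
  have pd\<kappa>: "pderiv_chart c k (\<lambda>s. K c s $ i $ i) q = frechet_derivative (\<kappa> i) (at (snd c q)) (axis k 1)" for i k q
    by (simp add: pderiv_chart_def \<kappa>_def)
  have bq: "1 / (K c r $ j $ j - K c r $ i $ i) * pderiv_chart c j (\<lambda>s. K c s $ i $ i) r = b i j (snd c r)"
    if "r \<in> fst c" for r i j
    using that c(1) by (simp add: b_def pd\<kappa>) (simp add: \<kappa>_def inv_chart_left divide_inverse)
  have closed: "frechet_derivative (b i j) (at x) (axis k 1) = frechet_derivative (b i k) (at x) (axis j 1)"
    if x: "x \<in> ?S" and ijk: "i \<noteq> j" "j \<noteq> k" "i \<noteq> k" for x i j k
  proof -
    obtain q where q: "x = snd c q" "q \<in> fst c" using x by blast
    have "pderiv_chart c m (\<lambda>r. 1 / (K c r $ l $ l - K c r $ i $ i) * pderiv_chart c l (\<lambda>s. K c s $ i $ i) r) q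
        = frechet_derivative (b i l) (at x) (axis m 1)" if "i \<noteq> l" for l m
    proof -
      have "frechet_derivative ((\<lambda>r. 1 / (K c r $ l $ l - K c r $ i $ i) * pderiv_chart c l (\<lambda>s. K c s $ i $ i) r) \<circ> inv_chart c) (at (snd c q))
        = frechet_derivative (b i l) (at (snd c q))"
        by (rule frechet_derivative_inv_chart_cong[OF c(1) open_UNIV q(2)])
          (use bq smooth_on_differentiable[OF smb[OF that]] q in auto)
      then show ?thesis by (simp add: pderiv_chart_def q(1))
    qed
    then show ?thesis using ham[OF ijk q(2)] ijk by simp
  qed
  obtain r where "r > 0" and r: "ball (snd c p) r \<subseteq> ?S"
    using oS c(2) open_contains_ball by blast
  have "\<exists>f. smooth_on f (ball (snd c p) r) \<and>
      (\<forall>x\<in>ball (snd c p) r. \<forall>j. j \<noteq> i \<longrightarrow> frechet_derivative f (at x) (axis j 1) = b i j x)" for i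
    by (rule poincare_without_coordinate[of i "b i" "snd c p" r])
      (use smooth_on_subset[OF smb r] closed r in \<open>auto dest: subsetD\<close>)
  then obtain f where smf: "\<And>i. smooth_on (f i) (ball (snd c p) r)"
    and df: "\<And>i j x. x \<in> ball (snd c p) r \<Longrightarrow> j \<noteq> i \<Longrightarrow> frechet_derivative (f i) (at x) (axis j 1) = b i j x"
    by metis
  define W where "W = fst c \<inter> snd c -` ball (snd c p) r"
  have W: "open W" "W \<subseteq> fst c" "p \<in> W"
    using continuous_open_preimage[OF homeomorphism_cont1[OF chart_homeomorphism[OF c(1)]] open_chart[OF c(1)], of "ball (snd c p) r"]
      \<open>r > 0\<close> c(2) by (auto simp: W_def)
  have sW: "snd c ` W \<subseteq> ball (snd c p) r" by (auto simp: W_def)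
  have oW: "open (snd c ` W)" using open_chart_image[OF c(1) W(1)] W(2) by (simp add: Int_absorb1)
  \<comment> \<open>The functions \<open>f i\<close> integrate the derivatives of -ln g_i, hence the
    minus sign; the exponential makes the diagonal entries nonzero without any further choice of
    sign.\<close>
  have sme: "smooth_on (\<lambda>x. exp (- f i x)) (snd c ` W)" for i
    by (intro smooth_on_exp smooth_on_minus oW smooth_on_subset[OF smf sW])
  obtain g where g: "metric_on \<A> W g"
    and gc: "\<And>q i j. q \<in> W \<Longrightarrow> g c q $ i $ j = (if i = j then exp (- f i (snd c q)) else 0)"
    by (rule diagonal_metric[OF c(1) W(1,2), of "\<lambda>i x. exp (- f i x)"]) (use sme in auto)
  have g2: "tensor02_on \<A> W g" using g by (simp add: metric_on_def)
  have Tc: "transpose (lower_index g K c q) = lower_index g K c q" if "q \<in> W" for q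
  proof -
    have lower: "lower_index g K c q $ i $ j = g c q $ i $ i * K c q $ i $ j" for i j
      by (rule lower_index_diagonal) (simp add: gc[OF that])
    have "lower_index g K c q $ j $ i = lower_index g K c q $ i $ j" for i j
      using that diagK W(2) by (cases "i = j") (auto simp: lower diagonal_on_def subset_iff)
    then show ?thesis by (simp add: transpose_def vec_eq_iff)
  qed
  have form: "killing_form g K c q v = 0" if q: "q \<in> W" for q v
  proof -
    have qc: "q \<in> fst c" using q W by blast
    have qb: "snd c q \<in> ball (snd c p) r" using q sW by blast
    have pdg: "pderiv_chart c k (\<lambda>q. g c q $ i $ i) q = - (exp (- f i (snd c q)) * frechet_derivative (f i) (at (snd c q)) (axis k 1))" for i k
    proof -
      have e: "((\<lambda>x. exp (- f i x)) has_derivative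
          (\<lambda>v. exp (- f i (snd c q)) * - frechet_derivative (f i) (at (snd c q)) v)) (at (snd c q))"
        by (auto intro!: derivative_eq_intros smooth_on_has_derivative[OF smf qb])
      have "frechet_derivative ((\<lambda>q. g c q $ i $ i) \<circ> inv_chart c) (at (snd c q)) = frechet_derivative (\<lambda>x. exp (- f i x)) (at (snd c q))"
        by (rule frechet_derivative_inv_chart_cong[OF c(1) W(1) qc q])
          (use e in \<open>auto simp: gc differentiable_def\<close>)
      then show ?thesis by (simp add: pderiv_chart_def frechet_derivative_at[OF e, symmetric])
    qed
    have "(\<forall>v. killing_form g K c q v = 0) \<longleftrightarrow> (\<forall>i k. g c q $ i $ i * pderiv_chart c k (\<lambda>q. K c q $ i $ i) q
      + pderiv_chart c k (\<lambda>q. g c q $ i $ i) q * (K c q $ k $ k - K c q $ i $ i) = 0)"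
      by (rule killing_form_diagonal[OF g K W(1) c(1) qc q diagK]) (simp add: gc)
    moreover have "g c q $ i $ i * pderiv_chart c k (\<lambda>q. K c q $ i $ i) q
      + pderiv_chart c k (\<lambda>q. g c q $ i $ i) q * (K c q $ k $ k - K c q $ i $ i) = 0" for i k
    \<comment> \<open>Weak nonlinearity settles the diagonal equations, and the construction of
      \<open>f i\<close> the remaining ones.\<close>
    proof (cases "i = k")
      case True
      then show ?thesis using weakly_nonlinear_diagonal[OF K wn c(1) diagK qc] by simp
    next
      case False
      have "frechet_derivative (f i) (at (snd c q)) (axis k 1) = b i k (snd c q)"
        using df[OF qb] False by simp
      also have "\<dots> = 1 / (K c q $ k $ k - K c q $ i $ i) * pderiv_chart c k (\<lambda>s. K c s $ i $ i) q"
        by (rule bq[OF qc, symmetric])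
      finally show ?thesis using neq[OF qc False] by (simp add: gc[OF q] pdg field_simps)
    qed
    ultimately show ?thesis by simp
  qed
  have Td: "transpose (lower_index g K d q) = lower_index g K d q" if "d \<in> \<A>" "q \<in> fst d" "q \<in> W" for d q
  proof -
    have "q \<in> fst c" using that W by blast
    then have "lower_index g K d q = transpose (jacobian d c q) ** lower_index g K c q ** jacobian d c q"
      using tensor02_lower_index[OF g2 K W(1)] c(1) that unfolding tensor02_on_def by blast
    then show ?thesis by (simp add: matrix_transpose_mul Tc[OF that(3)] matrix_mul_assoc)
  qed
  \<comment> \<open>An arbitrary chart \<open>d\<close> need not diagonalise anything. Symmetry
    passes to it by the tensor law, and the equation by evaluating the form of chart
    \<open>c\<close> at the transformed vector.\<close>
  have "killing_on \<A> W g (lower_index g K)"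
    unfolding killing_on_def
  proof (intro ballI conjI)
    fix d q assume d: "d \<in> \<A>" and "q \<in> fst d \<inter> W"
    then have q: "q \<in> fst d" "q \<in> W" "q \<in> fst c" using W by auto
    show "\<forall>i j. lower_index g K d q $ i $ j = lower_index g K d q $ j $ i"
    proof (intro allI)
      fix i j
      have "lower_index g K d q $ i $ j = transpose (lower_index g K d q) $ j $ i" by (simp add: transpose_def)
      then show "lower_index g K d q $ i $ j = lower_index g K d q $ j $ i" by (simp add: Td[OF d q(1,2)])
    qed
    show "\<forall>i j k. cov_deriv g (lower_index g K) d i j k q + cov_deriv g (lower_index g K) d j k i q
        + cov_deriv g (lower_index g K) d k i j q = 0"
      by (subst killing_equation_iff[OF g K W(1) d q(1,2) Td[OF d]])
        (simp_all add: killing_form_change_chart[OF g K W(1) c(1) d q(3,1,2) Tc[OF q(2)]] form[OF q(2)])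
  qed
  moreover have "\<exists>d\<in>\<A>. q \<in> fst d \<and> fst d \<subseteq> W \<and> diagonal_on d K" if "q \<in> W" for q
  proof (intro bexI conjI)
    \<comment> \<open>The domain of \<open>c\<close> may be larger than \<open>W\<close>, where
      alone \<open>g\<close> is a metric, so the diagonalising chart is cut down to
      \<open>W\<close>.\<close>
    let ?d = "(fst c \<inter> W, snd c)"
    show d: "?d \<in> \<A>" by (rule restrict_chart[OF c(1) W(1)])
    show "q \<in> fst ?d" "fst ?d \<subseteq> W" using that W by auto
    have "K ?d s = K c s" if "s \<in> fst c \<inter> W" for s
    proof -
      have "s \<in> fst c" "s \<in> fst ?d" "s \<in> UNIV" using that by auto
      then have "K ?d s = jacobian c ?d s ** K c s ** jacobian ?d c s"
        using K c(1) d unfolding tensor11_on_def by blast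
      then show ?thesis by (simp add: jacobian_restrict_chart[OF c(1) W(1) that])
    qed
    then show "diagonal_on ?d K" using diagK by (simp add: diagonal_on_def)
  qed
  ultimately have "generates_separation_on \<A> W g K"
    using dist by (auto simp: generates_separation_on_def distinct_eigenvalues_on_def)
  then show ?thesis using W g by blast
qed

end

theorem theorem1p1:
  fixes \<A> :: "('m::{t2_space, second_countable_topology}, 'n::finite) chart set"
    and K :: "('m, 'n) chart \<Rightarrow> 'm \<Rightarrow> real^'n^'n"
  assumes "smooth_structure \<A>"
    and "tensor11_on \<A> UNIV K"
    and "distinct_eigenvalues_on \<A> UNIV K"
    and "haantjes_vanishes \<A> K"
  shows "(\<forall>p. \<exists>W g. open W \<and> p \<in> W \<and> metric_on \<A> W g \<and> generates_separation_on \<A> W g K)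
    \<longleftrightarrow> weakly_nonlinear \<A> K \<and> semi_hamiltonian \<A> K"
proof -
  interpret smooth_manifold \<A> by unfold_locales fact
  show ?thesis
    by (intro iffI conjI allI; (elim conjE)?;
      rule separation_imp_weakly_nonlinear[OF assms(2)] separation_imp_semi_hamiltonian[OF assms(2)]
        semi_hamiltonian_imp_separation[OF assms(2,3)]; assumption)
qed

end
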